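(* Let $\ell$ be a smooth closed Jordan curve in $\mathbb{C}$ and let $\mathbb{G}$ be the bounded domain with boundary $\ell$. If $f\in E^{\infty}(\mathbb{G})$ and $f'\in E^{p}(\mathbb{G})$ for some $p>1$, then $f\in\mathfrak{M}(K)$.
   Context: "Smooth" means that the arc length parametrization of the closed curve $\ell$ is continuously differentiable as a periodic function (continuously turning tangent). Let $\zeta=\varphi(z)$ be a conformal mapping of the unit disc $\mathbb{D}$ onto $\mathbb{G}$ and, for $0<r<1$, let $\ell_r$ be the image of the circle $|z|=r$ under $\varphi$. For $0<p<\infty$, the Smirnov class $E^{p}(\mathbb{G})$ consists of the analytic functions $f$ on $\mathbb{G}$ with $$\|f\|_{E^p}^p=\sup_{0<r<1}\frac{1}{2\pi}\int_{\ell_r}|f(\zeta)|^p\,|d\zeta|<\infty .$$ $E^{\infty}(\mathbb{G})$ is the space of bounded analytic functions on $\mathbb{G}$. $M(\ell)$ is the space of finite complex Borel measures on $\ell$. $K(\mathbb{G})$ is the space of all analytic functions $g$ on $\mathbb{G}$ representable as $$g(z)=\int_{\ell}\frac{d\mu(\zeta)}{\zeta-z},\qquad z\in\mathbb{G},$$ for some $\mu\in M(\ell)$. $\mathfrak{M}(K)$ is the class of multipliers of $K(\mathbb{G})$: the set of analytic functions $f$ on $\mathbb{G}$ such that $fg\in K(\mathbb{G})$ for every $g\in K(\mathbb{G})$. *)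

theory Defs
  imports "HOL-Complex_Analysis.Complex_Analysis"
begin

text \<open>Smoothness is required of the arc length parametrization, i.e. the unit speed one, extended
  periodically to the whole line; so the tangent also turns continuously at the base point.\<close>

definition smooth_jordan_curve :: "complex set \<Rightarrow> bool" where
  "smooth_jordan_curve l \<longleftrightarrow>
     (\<exists>(L::real) (\<gamma>::real \<Rightarrow> complex).
        L > 0 \<and> (\<forall>s. \<gamma> (s + L) = \<gamma> s) \<and> inj_on \<gamma> {0..<L} \<and> \<gamma> ` {0..<L} = l \<and>
        \<gamma> C1_differentiable_on UNIV \<and> (\<forall>s. norm (vector_derivative \<gamma> (at s)) = 1))"

definition conformal_onto :: "(complex \<Rightarrow> complex) \<Rightarrow> complex set \<Rightarrow> complex set \<Rightarrow> bool" where
  "conformal_onto \<phi> D G \<longleftrightarrow> \<phi> holomorphic_on D \<and> inj_on \<phi> D \<and> \<phi> ` D = G"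

definition arc_length_integral :: "(real \<Rightarrow> complex) \<Rightarrow> (complex \<Rightarrow> real) \<Rightarrow> real" where
  "arc_length_integral g h =
     integral {0..1} (\<lambda>t. h (g t) * norm (vector_derivative g (at t within {0..1})))"

text \<open>The Smirnov class for a fixed conformal mapping \<open>\<phi>\<close> of the unit disc onto \<open>G\<close>
  and an exponent in \<open>(0, \<infinity>]\<close>.\<close>

definition smirnov_class ::
    "(complex \<Rightarrow> complex) \<Rightarrow> complex set \<Rightarrow> ereal \<Rightarrow> (complex \<Rightarrow> complex) set" where
  "smirnov_class \<phi> G p =
     {f. f holomorphic_on G \<and>
         (if p = \<infinity> then bounded (f ` G)
          else bdd_above ((\<lambda>r. 1 / (2 * pi) * arc_length_integral (\<phi> \<circ> circlepath 0 r)
                                    (\<lambda>\<zeta>. norm (f \<zeta>) powr real_of_ereal p)) ` {0<..<1}))}"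

text \<open>A complex measure on the measurable space of \<open>M\<close> (the measure carried by \<open>M\<close> is
  ignored) is a complex valued countably additive set function. The constant sequence of empty
  sets shows that it vanishes on the empty set.\<close>

definition complex_measure :: "'a measure \<Rightarrow> ('a set \<Rightarrow> complex) \<Rightarrow> bool" where
  "complex_measure M \<mu> \<longleftrightarrow>
     (\<forall>A::nat \<Rightarrow> 'a set. range A \<subseteq> sets M \<and> disjoint_family A \<longrightarrow>
        (\<lambda>n. \<mu> (A n)) sums \<mu> (\<Union>n. A n))"

text \<open>The upper variation of a real set function. The coercion \<open>ennreal\<close> truncates negative values
  to \<open>0\<close>, which does not affect the supremum because the empty set is among the sets \<open>B\<close>.\<close>

definition upper_variation :: "'a measure \<Rightarrow> ('a set \<Rightarrow> real) \<Rightarrow> 'a measure" where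
  "upper_variation M \<nu> =
     measure_of (space M) (sets M) (\<lambda>A. SUP B\<in>{B \<in> sets M. B \<subseteq> A}. ennreal (\<nu> B))"

text \<open>Integration through the Jordan decompositions of the real and imaginary parts.\<close>

definition complex_measure_integral ::
    "'a measure \<Rightarrow> ('a set \<Rightarrow> complex) \<Rightarrow> ('a \<Rightarrow> complex) \<Rightarrow> complex" where
  "complex_measure_integral M \<mu> h =
     (LINT x|upper_variation M (\<lambda>A. Re (\<mu> A)). h x)
     - (LINT x|upper_variation M (\<lambda>A. - Re (\<mu> A)). h x)
     + \<i> * ((LINT x|upper_variation M (\<lambda>A. Im (\<mu> A)). h x)
            - (LINT x|upper_variation M (\<lambda>A. - Im (\<mu> A)). h x))"

definition cauchy_class :: "complex set \<Rightarrow> complex set \<Rightarrow> (complex \<Rightarrow> complex) set" where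
  "cauchy_class l G =
     {g. g holomorphic_on G \<and>
         (\<exists>\<mu>. complex_measure (restrict_space borel l) \<mu> \<and>
              (\<forall>z\<in>G. g z = complex_measure_integral (restrict_space borel l) \<mu>
                             (\<lambda>\<zeta>. 1 / (\<zeta> - z))))}"

definition cauchy_multipliers :: "complex set \<Rightarrow> complex set \<Rightarrow> (complex \<Rightarrow> complex) set" where
  "cauchy_multipliers l G =
     {f. f holomorphic_on G \<and> (\<forall>g \<in> cauchy_class l G. (\<lambda>z. f z * g z) \<in> cauchy_class l G)}"

end

theory Submission
  imports Defs
begin

text \<open>Write the Smirnov condition in the disc: \<open>(f' \<circ> \<phi>) \<phi>'\<^sup>1\<^sup>/\<^sup>p\<close> lies in the Hardy space \<open>H\<^sup>p\<close>, so it
  grows at most like \<open>(1 - \<bar>w\<bar>)\<^sup>-\<^sup>1\<^sup>/\<^sup>p\<close>. By the Schwarz--Pick lemma for \<open>\<phi>\<^sup>-\<^sup>1\<close>,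
  \<open>(1 - \<bar>w\<bar>\<^sup>2) \<bar>\<phi>' w\<bar>\<close> is at least the distance \<open>d\<close> of \<open>\<phi> w\<close> to the curve. Hence \<open>\<bar>f'\<bar> \<le> C d\<^sup>-\<^sup>b\<close> with
  \<open>b < 1\<close>, and integrating along transversals to the curve shows that \<open>f\<close> has boundary values \<open>f*\<close>
  which are Hoelder continuous with exponent \<open>1 - b\<close>. For \<open>\<zeta>\<close> on the curve,
  \<open>f z / (\<zeta> - z) = f* \<zeta> / (\<zeta> - z) + (f z - f* \<zeta>) / (\<zeta> - z)\<close>, where the last quotient is the Cauchy integral of
  its boundary values; these are bounded by \<open>C \<bar>\<xi> - \<zeta>\<bar>\<^sup>-\<^sup>b\<close> and therefore integrable along the
  curve uniformly in \<open>\<zeta>\<close>. Integrating over \<open>\<zeta>\<close> and applying Fubini's theorem represents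
  \<open>f g\<close> as a Cauchy integral. No boundary behaviour of \<open>\<phi>\<close> is needed.\<close>

section \<open>Complex measures and Cauchy integrals\<close>

text \<open>The condition p > 1 enters through b < 1 (b = 1/p for finite p), and b < 1 is used
  twice: d^-b is integrable across the curve, which produces boundary values, and along it, which
  makes the correction to the measure an integrable density. The obstacle is that (f z -
  \<open>fhat\<close> \<zeta>) / (\<zeta> - z) may be unbounded near \<zeta>, so its Cauchy formula
  cannot be read off on the curve itself. It is taken on curves c x + t N x inside G, and t tends to
  0. With r = |c x - \<zeta>| the numerator is at most a constant times (t + r)^(1-b) and the
  denominator at least a constant times t + r, so r^-b dominates for all t at once. The measure
  obtained for f g is \<open>fhat\<close> times the given one plus a part with density \<psi> / (2
  pi \<i> w) in the parameter, where w is the winding number of the curve about the points of G; the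
  orientation never has to be determined. Complex measures are handled as finite linear combinations
  of positive ones, so that integration and Fubini's theorem apply term by term; the Jordan
  decomposition translates back to a complex measure.\<close>

definition signed_measure :: "'a measure \<Rightarrow> ('a set \<Rightarrow> real) \<Rightarrow> bool" where
  "signed_measure M \<nu> \<longleftrightarrow>
     (\<forall>A::nat \<Rightarrow> 'a set. range A \<subseteq> sets M \<and> disjoint_family A \<longrightarrow>
        (\<lambda>n. \<nu> (A n)) sums \<nu> (\<Union>n. A n))"

lemma signed_measure_sums:
  assumes "signed_measure M \<nu>" "\<And>n::nat. A n \<in> sets M" "disjoint_family A"
  shows "(\<lambda>n. \<nu> (A n)) sums \<nu> (\<Union>n. A n)"
  using assms unfolding signed_measure_def by blast

lemma signed_measure_minus: "signed_measure M \<nu> \<Longrightarrow> signed_measure M (\<lambda>A. - \<nu> A)"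
  unfolding signed_measure_def by (metis sums_minus)

lemma signed_measure_empty:
  assumes "signed_measure M \<nu>"
  shows "\<nu> {} = 0"
proof -
  have "(\<lambda>n::nat. \<nu> {}) sums \<nu> (\<Union>n::nat. {})"
    by (rule signed_measure_sums[OF assms]) (auto simp: disjoint_family_on_def)
  then show ?thesis
    by (metis sums_summable summable_const_iff)
qed

lemma signed_measure_Un:
  assumes \<nu>: "signed_measure M \<nu>" and "A \<in> sets M" "B \<in> sets M" "A \<inter> B = {}"
  shows "\<nu> (A \<union> B) = \<nu> A + \<nu> B"
proof -
  define C where "C = (\<lambda>n::nat. if n = 0 then A else if n = 1 then B else {})"
  have "(\<lambda>n. \<nu> (C n)) sums \<nu> (\<Union>n. C n)"
    using assms by (intro signed_measure_sums[OF \<nu>]) (auto simp: C_def disjoint_family_on_def)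
  moreover have "(\<Union>n. C n) = A \<union> B"
    by (force simp: C_def split: if_splits)
  moreover have "(\<lambda>n. \<nu> (C n)) sums (\<Sum>n\<in>{0,1}. \<nu> (C n))"
    by (rule sums_finite) (auto simp: C_def signed_measure_empty[OF \<nu>])
  ultimately show ?thesis
    by (simp add: sums_iff C_def)
qed

lemma signed_measure_Diff:
  assumes "signed_measure M \<nu>" "A \<in> sets M" "B \<in> sets M" "B \<subseteq> A"
  shows "\<nu> (A - B) = \<nu> A - \<nu> B"
proof -
  have "\<nu> (B \<union> (A - B)) = \<nu> B + \<nu> (A - B)"
    using assms by (intro signed_measure_Un) auto
  moreover have "B \<union> (A - B) = A" using assms by auto
  ultimately show ?thesis by simp
qed

lemma ennreal_add_le: "ennreal (a + b) \<le> ennreal a + ennreal b"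
proof (cases "a \<ge> 0 \<and> b \<ge> 0")
  case True
  then show ?thesis by simp
next
  case False
  then have "a + b \<le> a \<or> a + b \<le> b" by auto
  then show ?thesis
    by (meson add_increasing add_increasing2 ennreal_leI order_trans zero_le)
qed

lemma ennreal_sum_le: "ennreal (\<Sum>i<n. x i) \<le> (\<Sum>i<n::nat. ennreal (x i))"
proof (induction n)
  case (Suc n)
  then show ?case
    using ennreal_add_le[of "\<Sum>i<n. x i" "x n"] by (simp add: add_right_mono order_trans)
qed simp

abbreviation upper_sup :: "'a measure \<Rightarrow> ('a set \<Rightarrow> real) \<Rightarrow> 'a set \<Rightarrow> ennreal" where
  "upper_sup M \<nu> A \<equiv> SUP B\<in>{B \<in> sets M. B \<subseteq> A}. ennreal (\<nu> B)"

lemma upper_sup_superadditive: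
  assumes \<nu>: "signed_measure M \<nu>" and AB: "A \<in> sets M" "B \<in> sets M" "A \<inter> B = {}"
  shows "upper_sup M \<nu> A + upper_sup M \<nu> B \<le> upper_sup M \<nu> (A \<union> B)"
proof -
  have ne: "{C \<in> sets M. C \<subseteq> S} \<noteq> {}" for S by auto
  have *: "ennreal (\<nu> C) + ennreal (\<nu> D) \<le> upper_sup M \<nu> (A \<union> B)"
    if "C \<in> sets M" "C \<subseteq> A" "D \<in> sets M" "D \<subseteq> B" for C D
  proof -
    \<comment> \<open>\<open>ennreal\<close> sends negative values to 0, so a piece of nonpositive
      measure is dropped and the other piece alone competes in the supremum.\<close>
    consider "\<nu> C \<le> 0" | "\<nu> D \<le> 0" | "\<nu> C \<ge> 0" "\<nu> D \<ge> 0" by linarith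
    then show ?thesis
    proof cases
      case 1
      then show ?thesis using that by (auto simp: ennreal_neg intro!: SUP_upper)
    next
      case 2
      then show ?thesis using that by (auto simp: ennreal_neg intro!: SUP_upper)
    next
      case 3
      have "\<nu> (C \<union> D) = \<nu> C + \<nu> D"
        using that AB by (intro signed_measure_Un[OF \<nu>]) auto
      then have "ennreal (\<nu> C) + ennreal (\<nu> D) = ennreal (\<nu> (C \<union> D))"
        using 3 by simp
      also have "\<dots> \<le> upper_sup M \<nu> (A \<union> B)"
        using that by (intro SUP_upper) auto
      finally show ?thesis .
    qed
  qed
  show ?thesis
    unfolding ennreal_SUP_add_left[OF ne, symmetric]
    unfolding add.commute[of _ "upper_sup M \<nu> B"] ennreal_SUP_add_left[OF ne, symmetric]
    by (intro SUP_least) (use * in \<open>auto simp: add.commute\<close>)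
qed

text \<open>One inequality is finite superadditivity passed to the limit. For the other, a
  competitor B is cut into the pieces B \<inter> A i: countable additivity of \<nu> recovers its
  value, and truncation at 0 makes \<open>ennreal\<close> subadditive, so the partial sums stay
  below the sum of the suprema.\<close>

lemma upper_sup_countably_additive:
  assumes \<nu>: "signed_measure M \<nu>"
  shows "countably_additive (sets M) (upper_sup M \<nu>)"
proof (rule countably_additiveI)
  fix A :: "nat \<Rightarrow> 'a set"
  assume A: "range A \<subseteq> sets M" and dis: "disjoint_family A" and "(\<Union>i. A i) \<in> sets M"
  then have Am[measurable]: "\<And>i. A i \<in> sets M" by auto
  let ?V = "upper_sup M \<nu>"
  have fin: "(\<Sum>i<n. ?V (A i)) \<le> ?V (\<Union>i<n. A i)" for n
  proof (induction n)
    case (Suc n)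
    have "A i \<inter> A n = {}" if "i < n" for i
      using dis that unfolding disjoint_family_on_def by (metis UNIV_I nat_neq_iff)
    then have dn: "(\<Union>i<n. A i) \<inter> A n = {}" by blast
    have "(\<Sum>i<Suc n. ?V (A i)) \<le> ?V (\<Union>i<n. A i) + ?V (A n)"
      using Suc by (simp add: add_right_mono)
    also have "\<dots> \<le> ?V ((\<Union>i<n. A i) \<union> A n)"
      using dis by (intro upper_sup_superadditive[OF \<nu>]) (use dn in auto)
    finally show ?case by (simp add: lessThan_Suc Un_commute)
  qed simp
  have mono: "?V (\<Union>i<n. A i) \<le> ?V (\<Union>i. A i)" for n
    by (intro SUP_subset_mono) auto
  have le: "(\<Sum>i. ?V (A i)) \<le> ?V (\<Union>i. A i)"
    by (rule suminf_le_const) (use fin mono in \<open>auto intro: order_trans\<close>)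
  have "ennreal (\<nu> B) \<le> (\<Sum>i. ?V (A i))" if B[measurable]: "B \<in> sets M" and sub: "B \<subseteq> (\<Union>i. A i)" for B
  proof -
    have "(\<lambda>n. \<nu> (B \<inter> A n)) sums \<nu> (\<Union>n. B \<inter> A n)"
      by (rule signed_measure_sums[OF \<nu>]) (use dis in \<open>auto simp: disjoint_family_on_def\<close>)
    moreover have "(\<Union>n. B \<inter> A n) = B" using sub by auto
    ultimately have "(\<lambda>n. ennreal (\<Sum>i<n. \<nu> (B \<inter> A i))) \<longlonglongrightarrow> ennreal (\<nu> B)"
      by (auto simp: sums_def intro: tendsto_ennrealI)
    moreover have "ennreal (\<Sum>i<n. \<nu> (B \<inter> A i)) \<le> (\<Sum>i. ?V (A i))" for n
    proof -
      have "ennreal (\<Sum>i<n. \<nu> (B \<inter> A i)) \<le> (\<Sum>i<n. ennreal (\<nu> (B \<inter> A i)))"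
        by (rule ennreal_sum_le)
      also have "\<dots> \<le> (\<Sum>i<n. ?V (A i))"
        by (intro sum_mono SUP_upper) auto
      also have "\<dots> \<le> (\<Sum>i. ?V (A i))"
        by (rule sum_le_suminf) auto
      finally show ?thesis .
    qed
    ultimately show ?thesis
      by (intro LIMSEQ_le_const2) auto
  qed
  then have "?V (\<Union>i. A i) \<le> (\<Sum>i. ?V (A i))"
    by (intro SUP_least) auto
  with le show "(\<Sum>i. ?V (A i)) = ?V (\<Union>i. A i)" by (rule antisym)
qed

lemma sets_upper_variation [simp]: "sets (upper_variation M \<nu>) = sets M"
  and space_upper_variation [simp]: "space (upper_variation M \<nu>) = space M"
  unfolding upper_variation_def by simp_all

lemma emeasure_upper_variation:
  assumes \<nu>: "signed_measure M \<nu>" and "A \<in> sets M"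
  shows "emeasure (upper_variation M \<nu>) A = upper_sup M \<nu> A"
  unfolding upper_variation_def
proof (rule emeasure_measure_of_sigma)
  have "{B \<in> sets M. B \<subseteq> {}} = {{}}" by auto
  then show "positive (sets M) (upper_sup M \<nu>)"
    using signed_measure_empty[OF \<nu>] by (simp add: positive_def)
qed (use assms upper_sup_countably_additive sets.sigma_algebra_axioms in auto)

text \<open>If a set of infinite variation existed, one could split off a piece \<open>E\<close> with \<open>\<bar>\<nu> E\<bar> \<ge> 1\<close> so that
  the rest still has infinite variation; iterating contradicts the convergence of the series of the
  measures of the pieces.\<close>

lemma upper_variation_finite:
  assumes \<nu>: "signed_measure M \<nu>"
  shows "finite_measure (upper_variation M \<nu>)"
proof (rule finite_measureI, rule notI)
  let ?V = "upper_variation M \<nu>"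
  assume "emeasure ?V (space ?V) = \<infinity>"
  then have top: "emeasure ?V (space M) = \<infinity>" by simp
  define P where "P = (\<lambda>E. E \<in> sets M \<and> emeasure ?V E = \<infinity>)"
  have step: "\<exists>F. P F \<and> F \<subseteq> E \<and> \<bar>\<nu> (E - F)\<bar> \<ge> 1" if "P E" for E
  proof -
    have E: "E \<in> sets M" and t: "emeasure ?V E = \<infinity>" using that by (auto simp: P_def)
    \<comment> \<open>The threshold exceeds |\<nu> E| by 1 so that both |\<nu> B| and |\<nu> (E -
      B)| = |\<nu> E - \<nu> B| are at least 1: whichever half keeps infinite variation, the half
      removed counts.\<close>
    have "ennreal (1 + \<bar>\<nu> E\<bar>) < upper_sup M \<nu> E"
      unfolding emeasure_upper_variation[OF \<nu> E, symmetric] t by simp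
    then obtain B where B: "B \<in> sets M" "B \<subseteq> E" "ennreal (1 + \<bar>\<nu> E\<bar>) < ennreal (\<nu> B)"
      by (auto simp: less_SUP_iff)
    from B(3) have b: "1 + \<bar>\<nu> E\<bar> < \<nu> B" by (subst (asm) ennreal_less_iff) auto
    have d: "\<nu> (E - B) = \<nu> E - \<nu> B" using B E by (intro signed_measure_Diff[OF \<nu>]) auto
    have "emeasure ?V B + emeasure ?V (E - B) = emeasure ?V E"
      using B E by (subst plus_emeasure) (auto intro!: arg_cong[where f = "emeasure ?V"])
    then consider "emeasure ?V B = \<infinity>" | "emeasure ?V (E - B) = \<infinity>"
      using t by (metis ennreal_add_eq_top infinity_ennreal_def)
    then show ?thesis
    proof cases
      case 1
      then show ?thesis using B E b d by (intro exI[of _ B]) (auto simp: P_def)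
    next
      case 2
      have "E - (E - B) = B" using B by auto
      then show ?thesis using 2 B E b by (intro exI[of _ "E - B"]) (auto simp: P_def)
    qed
  qed
  have "\<exists>E::nat \<Rightarrow> 'a set. \<forall>n. P (E n) \<and> (E (Suc n) \<subseteq> E n \<and> \<bar>\<nu> (E n - E (Suc n))\<bar> \<ge> 1)"
    by (rule dependent_nat_choice) (use top step in \<open>auto simp: P_def\<close>)
  then obtain E where E: "\<And>n. E n \<in> sets M" "\<And>n. E (Suc n) \<subseteq> E n"
    and ge: "\<And>n. \<bar>\<nu> (E n - E (Suc n))\<bar> \<ge> 1"
    by (auto simp: P_def)
  have anti: "E n \<subseteq> E m" if "m \<le> n" for m n
    using lift_Suc_antimono_le[of E] E(2) that by blast
  have disj: "disjoint_family (\<lambda>n. E n - E (Suc n))"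
  unfolding disjoint_family_on_def
  proof (intro ballI impI)
    fix m n :: nat assume "m \<noteq> n"
    then consider "Suc m \<le> n" | "Suc n \<le> m" by linarith
    then show "(E m - E (Suc m)) \<inter> (E n - E (Suc n)) = {}"
      by cases (use anti in blast)+
  qed
  have "(\<lambda>n. \<nu> (E n - E (Suc n))) \<longlonglongrightarrow> 0"
    by (rule summable_LIMSEQ_zero, rule sums_summable, rule signed_measure_sums[OF \<nu> _ disj]) (use E in auto)
  then have "(\<lambda>n. \<bar>\<nu> (E n - E (Suc n))\<bar>) \<longlonglongrightarrow> 0" by (rule tendsto_rabs_zero)
  then have "1 \<le> (0::real)" by (rule LIMSEQ_le_const) (use ge in auto)
  then show False by simp
qed

text \<open>For B \<subseteq> A one has \<nu> B = \<nu> A - \<nu> (A - B), which is at most \<nu> A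
  plus the upper variation of -\<nu> on A. The supremum over B gives one inequality and the same
  argument for -\<nu> the other; finiteness of the variations makes this an equation between
  reals.\<close>

lemma jordan_decomposition:
  assumes \<nu>: "signed_measure M \<nu>" and A: "A \<in> sets M"
  shows "\<nu> A = measure (upper_variation M \<nu>) A - measure (upper_variation M (\<lambda>A. - \<nu> A)) A"
proof -
  have le: "measure (upper_variation M \<nu>) A \<le> \<nu> A + measure (upper_variation M (\<lambda>A. - \<nu> A)) A"
    if \<nu>: "signed_measure M \<nu>" for \<nu>
  proof -
    interpret U: finite_measure "upper_variation M \<nu>" by (rule upper_variation_finite[OF \<nu>])
    interpret W: finite_measure "upper_variation M (\<lambda>A. - \<nu> A)"
      by (rule upper_variation_finite[OF signed_measure_minus[OF \<nu>]])
    have *: "\<nu> B \<le> \<nu> A + measure (upper_variation M (\<lambda>A. - \<nu> A)) A" if "B \<in> sets M" "B \<subseteq> A" for B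
    proof -
      have "ennreal (- \<nu> (A - B)) \<le> emeasure (upper_variation M (\<lambda>A. - \<nu> A)) A"
        unfolding emeasure_upper_variation[OF signed_measure_minus[OF \<nu>] A]
        using that A by (intro SUP_upper) auto
      then have "- \<nu> (A - B) \<le> measure (upper_variation M (\<lambda>A. - \<nu> A)) A"
        by (simp add: W.emeasure_eq_measure ennreal_le_iff)
      then show ?thesis
        using signed_measure_Diff[OF \<nu> A that] by simp
    qed
    have "0 \<le> \<nu> A + measure (upper_variation M (\<lambda>A. - \<nu> A)) A"
      using *[of "{}"] signed_measure_empty[OF \<nu>] by simp
    moreover have "emeasure (upper_variation M \<nu>) A \<le> ennreal (\<nu> A + measure (upper_variation M (\<lambda>A. - \<nu> A)) A)"
      unfolding emeasure_upper_variation[OF \<nu> A] using * by (intro SUP_least ennreal_leI) auto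
    ultimately show ?thesis
      by (simp add: U.emeasure_eq_measure ennreal_le_iff)
  qed
  show ?thesis
    using le[OF \<nu>] le[OF signed_measure_minus[OF \<nu>]] by simp
qed

lemma complex_measure_Re: "complex_measure M \<mu> \<Longrightarrow> signed_measure M (\<lambda>A. Re (\<mu> A))"
  and complex_measure_Im: "complex_measure M \<mu> \<Longrightarrow> signed_measure M (\<lambda>A. Im (\<mu> A))"
  unfolding complex_measure_def signed_measure_def using sums_Re sums_Im by blast+

section \<open>Cauchy integrals of finite combinations of positive measures\<close>

lemma tendsto_sum_list:
  fixes f :: "'a \<Rightarrow> 'b \<Rightarrow> complex"
  assumes "\<And>x. x \<in> set xs \<Longrightarrow> (f x \<longlongrightarrow> g x) F"
  shows "((\<lambda>n. \<Sum>x\<leftarrow>xs. f x n) \<longlongrightarrow> (\<Sum>x\<leftarrow>xs. g x)) F"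
  using assms by (induction xs) (auto intro!: tendsto_intros)

text \<open>Serves to show that integrals do not depend on the chosen combination: two combinations
  with equal values on sets are moved to one side. For simple functions the claim follows by
  grouping over their values; the approximants satisfy |s i| \<le> 2 |h|, so 2 K dominates in each
  finite measure.\<close>

lemma integral_combination_eq_0:
  fixes h :: "'a \<Rightarrow> complex" and ms :: "(complex \<times> 'a measure) list"
  assumes fin: "\<And>a M. (a, M) \<in> set ms \<Longrightarrow> finite_measure M"
    and sets: "\<And>a M. (a, M) \<in> set ms \<Longrightarrow> sets M = sets X"
    and null: "\<And>A. A \<in> sets X \<Longrightarrow> (\<Sum>(a, M)\<leftarrow>ms. a * of_real (measure M A)) = 0"
    and h: "h \<in> borel_measurable X" and bd: "\<And>x. x \<in> space X \<Longrightarrow> norm (h x) \<le> K"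
  shows "(\<Sum>(a, M)\<leftarrow>ms. a * (LINT x|M. h x)) = 0"
proof -
  obtain s where "\<forall>i::nat. simple_function X (s i)" 
    and "\<forall>x\<in>space X. (\<lambda>i. s i x) \<longlonglongrightarrow> h x"
    and "\<forall>i. \<forall>x\<in>space X. dist (s i x) 0 \<le> 2 * dist (h x) 0"
    using borel_measurable_implies_sequence_metric[OF h, of 0] by (elim exE conjE)
  then have s: "\<And>i::nat. simple_function X (s i)" 
    and lim: "\<And>x. x \<in> space X \<Longrightarrow> (\<lambda>i. s i x) \<longlonglongrightarrow> h x"
    and sb: "\<And>i x. x \<in> space X \<Longrightarrow> norm (s i x) \<le> 2 * norm (h x)"
    by simp_all
  have sp: "space M = space X" if "(a, M) \<in> set ms" for a M
    using sets[OF that] by (rule sets_eq_imp_space_eq)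
  have zero: "(\<Sum>(a, M)\<leftarrow>ms. a * (LINT x|M. s i x)) = 0" for i
  proof -
    have "(LINT x|M. s i x) = (\<Sum>y\<in>s i ` space X. measure M {x \<in> space X. s i x = y} *\<^sub>R y)"
      if "(a, M) \<in> set ms" for a M
    proof -
      interpret finite_measure M by (rule fin[OF that])
      have "simple_function M (s i)"
        using s[of i] sets[OF that] sp[OF that] by (simp add: simple_function_def)
      then have "Bochner_Integration.simple_bochner_integrable M (s i)"
        by (simp add: simple_bochner_integrable.simps emeasure_finite)
      then have "(LINT x|M. s i x) = Bochner_Integration.simple_bochner_integral M (s i)"
        by (rule simple_bochner_integrable_eq_integral[symmetric])
      then show ?thesis
        by (simp add: simple_bochner_integral_def sp[OF that])
    qed
    then have "(\<Sum>(a, M)\<leftarrow>ms. a * (LINT x|M. s i x)) =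
        (\<Sum>(a, M)\<leftarrow>ms. a * (\<Sum>y\<in>s i ` space X. measure M {x \<in> space X. s i x = y} *\<^sub>R y))"
      by (intro arg_cong[where f = sum_list] map_cong) auto
    also have "\<dots> = (\<Sum>y\<in>s i ` space X. (\<Sum>(a, M)\<leftarrow>ms. a * of_real (measure M {x \<in> space X. s i x = y})) * y)"
      by (induction ms) (auto simp: sum.distrib sum_distrib_left algebra_simps scaleR_conv_of_real)
    also have "\<dots> = 0"
    proof (intro sum.neutral ballI)
      fix y assume "y \<in> s i ` space X"
      have "s i -` {y} \<inter> space X \<in> sets X"
        using simple_functionD(2)[OF s] .
      also have "s i -` {y} \<inter> space X = {x \<in> space X. s i x = y}" by auto
      finally show "(\<Sum>(a, M)\<leftarrow>ms. a * of_real (measure M {x \<in> space X. s i x = y})) * y = 0"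
        using null by simp
    qed
    finally show ?thesis .
  qed
  have "(\<lambda>i. \<Sum>m\<leftarrow>ms. fst m * (LINT x|snd m. s i x)) \<longlonglongrightarrow> (\<Sum>m\<leftarrow>ms. fst m * (LINT x|snd m. h x))"
  proof (rule tendsto_sum_list)
    fix m assume m: "m \<in> set ms"
    define M where "M = snd m"
    have mem: "(fst m, M) \<in> set ms" using m by (simp add: M_def)
    interpret finite_measure M by (rule fin[OF mem])
    have "(\<lambda>i. LINT x|M. s i x) \<longlonglongrightarrow> (LINT x|M. h x)"
    proof (rule integral_dominated_convergence[where w = "\<lambda>x. 2 * K"])
      show "h \<in> borel_measurable M" using h sets[OF mem] by (simp cong: measurable_cong_sets)
      show "s i \<in> borel_measurable M" for i
        using borel_measurable_simple_function[OF s[of i]] sets[OF mem] by (simp cong: measurable_cong_sets)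
      show "AE x in M. norm (s i x) \<le> 2 * K" for i
        using sb bd sp[OF mem] by (intro AE_I2) (metis mult_left_mono order_trans zero_le_numeral)
    qed (use lim sp[OF mem] in auto)
    then show "(\<lambda>i. fst m * (LINT x|snd m. s i x)) \<longlonglongrightarrow> fst m * (LINT x|snd m. h x)"
      by (auto simp: M_def intro: tendsto_intros)
  qed
  moreover have "(\<Sum>m\<leftarrow>ms. fst m * (LINT x|snd m. s i x)) = 0" for i
    using zero[of i] by (simp add: case_prod_beta')
  ultimately show ?thesis
    by (simp add: case_prod_beta' LIMSEQ_const_iff)
qed

text \<open>Coefficients paired with positive measures in a list: sums become concatenation, scalars
  act on the coefficients, and every entry is an ordinary finite measure. For holomorphic functions
  on an open G disjoint from l this amounts to membership in \<open>cauchy_class\<close>.\<close>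

definition cauchy_rep :: "complex set \<Rightarrow> complex set \<Rightarrow> (complex \<Rightarrow> complex) \<Rightarrow> bool" where
  "cauchy_rep l G g \<longleftrightarrow>
     (\<exists>ms. (\<forall>(a, M)\<in>set ms. finite_measure M \<and> sets M = sets (restrict_space borel l)) \<and>
           (\<forall>z\<in>G. g z = (\<Sum>(a, M)\<leftarrow>ms. a * (LINT \<zeta>|M. 1 / (\<zeta> - z)))))"

lemma cauchy_class_imp_rep:
  assumes "g \<in> cauchy_class l G"
  shows "cauchy_rep l G g"
proof -
  let ?X = "restrict_space borel l"
  obtain \<mu> where \<mu>: "complex_measure ?X \<mu>"
    and g: "\<And>z. z \<in> G \<Longrightarrow> g z = complex_measure_integral ?X \<mu> (\<lambda>\<zeta>. 1 / (\<zeta> - z))"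
    using assms by (auto simp: cauchy_class_def)
  note R = complex_measure_Re[OF \<mu>] and I = complex_measure_Im[OF \<mu>]
  show ?thesis
    unfolding cauchy_rep_def
  proof (intro exI conjI ballI)
    let ?ms = "[(1, upper_variation ?X (\<lambda>A. Re (\<mu> A))), (-1, upper_variation ?X (\<lambda>A. - Re (\<mu> A))),
      (\<i>, upper_variation ?X (\<lambda>A. Im (\<mu> A))), (-\<i>, upper_variation ?X (\<lambda>A. - Im (\<mu> A)))]"
    show "case x of (a, M) \<Rightarrow> finite_measure M \<and> sets M = sets ?X" if "x \<in> set ?ms" for x
      using that upper_variation_finite[OF R] upper_variation_finite[OF signed_measure_minus[OF R]]
        upper_variation_finite[OF I] upper_variation_finite[OF signed_measure_minus[OF I]]
      by auto
    show "g z = (\<Sum>(a, M)\<leftarrow>?ms. a * (LINT \<zeta>|M. 1 / (\<zeta> - z)))" if "z \<in> G" for z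
      by (simp add: g[OF that] complex_measure_integral_def algebra_simps)
  qed
qed

lemma cauchy_kernel_bounded:
  fixes z :: complex
  assumes "open G" "G \<inter> l = {}" "z \<in> G"
  obtains K where "\<And>\<zeta>. \<zeta> \<in> l \<Longrightarrow> norm (1 / (\<zeta> - z)) \<le> K"
proof -
  obtain e where e: "e > 0" "ball z e \<subseteq> G" using assms openE by blast
  have "norm (1 / (\<zeta> - z)) \<le> 1 / e" if "\<zeta> \<in> l" for \<zeta>
  proof -
    have "\<zeta> \<notin> ball z e" using that assms e by auto
    then have "e \<le> norm (\<zeta> - z)" by (simp add: dist_norm norm_minus_commute)
    then show ?thesis using e by (simp add: norm_divide frac_le)
  qed
  then show ?thesis using that by blast
qed

lemma complex_measure_combination:
  assumes "\<And>a M. (a, M) \<in> set ms \<Longrightarrow> finite_measure M \<and> sets M = sets X"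
  shows "complex_measure X (\<lambda>A. \<Sum>(a, M)\<leftarrow>ms. a * of_real (measure M A))"
  unfolding complex_measure_def
proof (intro allI impI, elim conjE)
  fix A :: "nat \<Rightarrow> 'a set" assume A: "range A \<subseteq> sets X" "disjoint_family A"
  show "(\<lambda>n. \<Sum>(a, M)\<leftarrow>ms. a * complex_of_real (measure M (A n))) sums
      (\<Sum>(a, M)\<leftarrow>ms. a * complex_of_real (measure M (\<Union>n. A n)))"
    using assms
  proof (induction ms)
    case (Cons m ms)
    obtain a M where m: "m = (a, M)" by (cases m)
    interpret finite_measure M using Cons.prems m by auto
    have "sets M = sets X" using Cons.prems m by auto
    then have "(\<lambda>n. a * of_real (measure M (A n))) sums (a * of_real (measure M (\<Union>n. A n)))"
      using A by (intro sums_mult sums_of_real finite_measure_UNION) auto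
    moreover have "(\<lambda>n. \<Sum>(a, M)\<leftarrow>ms. a * complex_of_real (measure M (A n))) sums
      (\<Sum>(a, M)\<leftarrow>ms. a * complex_of_real (measure M (\<Union>n. A n)))"
      by (rule Cons.IH) (use Cons.prems in auto)
    ultimately show ?case by (simp add: m sums_add)
  qed simp
qed

text \<open>The combination defines a complex measure, whose Jordan decompositions form a second
  combination with the same values on sets; \<open>integral_combination_eq_0\<close> for their
  difference identifies the Cauchy integrals. The kernel is bounded on l because z has a
  neighbourhood inside G.\<close>

lemma cauchy_rep_imp_class:
  assumes hol: "g holomorphic_on G" and rep: "cauchy_rep l G g" and G: "open G" "G \<inter> l = {}"
  shows "g \<in> cauchy_class l G"
proof -
  let ?X = "restrict_space (borel :: complex measure) l"
  obtain ms where "\<forall>(a, M)\<in>set ms. finite_measure M \<and> sets M = sets ?X"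
    and "\<forall>z\<in>G. g z = (\<Sum>(a, M)\<leftarrow>ms. a * (LINT \<zeta>|M. 1 / (\<zeta> - z)))"
    using rep unfolding cauchy_rep_def by (elim exE conjE)
  then have ms: "\<And>a M. (a, M) \<in> set ms \<Longrightarrow> finite_measure M \<and> sets M = sets ?X"
    and g: "\<And>z. z \<in> G \<Longrightarrow> g z = (\<Sum>(a, M)\<leftarrow>ms. a * (LINT \<zeta>|M. 1 / (\<zeta> - z)))"
    by fast+
  define \<mu> where "\<mu> = (\<lambda>A. \<Sum>(a, M)\<leftarrow>ms. a * of_real (measure M A))"
  have \<mu>: "complex_measure ?X \<mu>"
    unfolding \<mu>_def using ms by (rule complex_measure_combination)
  note R = complex_measure_Re[OF \<mu>] and I = complex_measure_Im[OF \<mu>]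
  have "g z = complex_measure_integral ?X \<mu> (\<lambda>\<zeta>. 1 / (\<zeta> - z))" if z: "z \<in> G" for z
  proof -
    obtain K where K: "\<And>\<zeta>. \<zeta> \<in> l \<Longrightarrow> norm (1 / (\<zeta> - z)) \<le> K"
      using cauchy_kernel_bounded[OF G z] by blast
    \<comment> \<open>Signs opposite to those in \<open>complex_measure_integral\<close>, so that
      appending this list to \<open>ms\<close> cancels on every set.\<close>
    let ?ns = "[(-1, upper_variation ?X (\<lambda>A. Re (\<mu> A))), (1, upper_variation ?X (\<lambda>A. - Re (\<mu> A))),
      (-\<i>, upper_variation ?X (\<lambda>A. Im (\<mu> A))), (\<i>, upper_variation ?X (\<lambda>A. - Im (\<mu> A)))]"
    have "(\<Sum>(a, M)\<leftarrow>ms @ ?ns. a * (LINT \<zeta>|M. 1 / (\<zeta> - z))) = 0"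
    proof (rule integral_combination_eq_0[where X = ?X])
      show "(\<Sum>(a, M)\<leftarrow>ms @ ?ns. a * of_real (measure M A)) = 0" if "A \<in> sets ?X" for A
        using jordan_decomposition[OF R that] jordan_decomposition[OF I that]
        unfolding map_append sum_list_append \<mu>_def[symmetric]
        by (simp add: complex_eq_iff fun_cong[OF \<mu>_def, symmetric])
      show "(\<lambda>\<zeta>. 1 / (\<zeta> - z)) \<in> borel_measurable ?X"
        by (rule measurable_restrict_space1) measurable
    qed (use ms K upper_variation_finite[OF R] upper_variation_finite[OF signed_measure_minus[OF R]]
        upper_variation_finite[OF I] upper_variation_finite[OF signed_measure_minus[OF I]]
        in \<open>auto simp: space_restrict_space\<close>)
    then show ?thesis
      by (simp add: g[OF z] complex_measure_integral_def algebra_simps)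
  qed
  with hol \<mu> show ?thesis by (auto simp: cauchy_class_def)
qed

lemma cauchy_rep_add:
  assumes "cauchy_rep l G g" "cauchy_rep l G h"
  shows "cauchy_rep l G (\<lambda>z. g z + h z)"
proof -
  obtain ms ns where "\<forall>(a, M)\<in>set ms. finite_measure M \<and> sets M = sets (restrict_space borel l)"
     "\<forall>z\<in>G. g z = (\<Sum>(a, M)\<leftarrow>ms. a * (LINT \<zeta>|M. 1 / (\<zeta> - z)))"
     "\<forall>(a, M)\<in>set ns. finite_measure M \<and> sets M = sets (restrict_space borel l)"
     "\<forall>z\<in>G. h z = (\<Sum>(a, M)\<leftarrow>ns. a * (LINT \<zeta>|M. 1 / (\<zeta> - z)))"
    using assms unfolding cauchy_rep_def by blast
  then show ?thesis
    unfolding cauchy_rep_def by (intro exI[of _ "ms @ ns"]) auto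
qed

lemma cauchy_rep_scale:
  assumes "cauchy_rep l G g"
  shows "cauchy_rep l G (\<lambda>z. a * g z)"
proof -
  obtain ms where ms: "\<forall>(a, M)\<in>set ms. finite_measure M \<and> sets M = sets (restrict_space borel l)"
     "\<forall>z\<in>G. g z = (\<Sum>(a, M)\<leftarrow>ms. a * (LINT \<zeta>|M. 1 / (\<zeta> - z)))"
    using assms unfolding cauchy_rep_def by blast
  have "a * (\<Sum>(b, M)\<leftarrow>ms. b * (LINT \<zeta>|M. 1 / (\<zeta> - z))) =
      (\<Sum>(b, M)\<leftarrow>map (\<lambda>(b, M). (a * b, M)) ms. b * (LINT \<zeta>|M. 1 / (\<zeta> - z)))" for z
    by (simp add: sum_list_const_mult case_prod_beta' o_def mult.assoc flip: sum_list_const_mult)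
  with ms show ?thesis
    unfolding cauchy_rep_def by (intro exI[of _ "map (\<lambda>(b, M). (a * b, M)) ms"]) auto
qed

lemma cauchy_rep_cong:
  assumes "cauchy_rep l G g" "\<And>z. z \<in> G \<Longrightarrow> h z = g z"
  shows "cauchy_rep l G h"
  using assms unfolding cauchy_rep_def by simp

lemma cauchy_rep_sum_list:
  assumes "\<And>x. x \<in> set xs \<Longrightarrow> cauchy_rep l G (g x)"
  shows "cauchy_rep l G (\<lambda>z. \<Sum>x\<leftarrow>xs. g x z)"
  using assms
proof (induction xs)
  case Nil
  show ?case unfolding cauchy_rep_def by (intro exI[of _ "[]"]) auto
qed (auto intro: cauchy_rep_add)

text \<open>The positive and negative parts of Re w and Im w are densities of four finite measures,
  which c pushes forward to the curve. The form covers both a density with respect to a measure on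
  the curve (c the identity) and a density in the parameter.\<close>

lemma cauchy_rep_integral:
  fixes w :: "'a \<Rightarrow> complex"
  assumes w: "integrable N w" and c: "c \<in> measurable N (restrict_space borel l)"
    and G: "open G" "G \<inter> l = {}"
  shows "cauchy_rep l G (\<lambda>z. LINT x|N. w x / (c x - z))"
proof -
  let ?X = "restrict_space (borel :: complex measure) l"
  note [measurable] = c borel_measurable_integrable[OF w]
  have cb[measurable]: "c \<in> borel_measurable N"
    using measurable_restrict_space2_iff[of c N borel l] c by blast
  have cl: "c x \<in> l" if "x \<in> space N" for x
    using measurable_space[OF c that] by (simp add: space_restrict_space)
  define D where "D = (\<lambda>u::'a \<Rightarrow> real. distr (density N (\<lambda>x. ennreal (max 0 (u x)))) ?X c)"
  have fin: "finite_measure (D u)" if u: "integrable N u" for u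
  proof (rule finite_measureI)
    note [measurable] = borel_measurable_integrable[OF u]
    have "emeasure (D u) (space (D u)) = emeasure (density N (\<lambda>x. ennreal (max 0 (u x)))) (space N)"
      unfolding D_def using cl
      by (subst emeasure_distr) (use sets.top[of "?X"] in \<open>auto intro!: arg_cong2[where f = emeasure] simp: space_restrict_space\<close>)
    also have "\<dots> = (\<integral>\<^sup>+x. ennreal (max 0 (u x)) \<partial>N)"
      by (subst emeasure_density) (auto intro!: nn_integral_cong)
    also have "\<dots> < \<infinity>"
      using Bochner_Integration.integrable_max[OF integrable_zero u] by (simp add: integrable_iff_bounded)
    finally show "emeasure (D u) (space (D u)) \<noteq> \<infinity>" by simp
  qed
  have int: "(LINT \<zeta>|D u. 1 / (\<zeta> - z)) = (LINT x|N. of_real (max 0 (u x)) / (c x - z))"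
    if u: "integrable N u" for u z
  proof -
    note [measurable] = borel_measurable_integrable[OF u]
    have "(LINT \<zeta>|D u. 1 / (\<zeta> - z)) = (LINT x|density N (\<lambda>x. ennreal (max 0 (u x))). 1 / (c x - z))"
      unfolding D_def by (subst integral_distr) (auto intro: measurable_restrict_space1)
    also have "\<dots> = (LINT x|N. max 0 (u x) *\<^sub>R (1 / (c x - z)))"
      by (subst integral_density) auto
    finally show ?thesis by (simp add: scaleR_conv_of_real)
  qed
  have intg: "integrable N (\<lambda>x. of_real (u x) / (c x - z))" if u: "integrable N u" and z: "z \<in> G" for u :: "'a \<Rightarrow> real" and z
  proof -
    note [measurable] = borel_measurable_integrable[OF u]
    obtain K where K: "\<And>\<zeta>. \<zeta> \<in> l \<Longrightarrow> norm (1 / (\<zeta> - z)) \<le> K"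
      using cauchy_kernel_bounded[OF G z] by blast
    show ?thesis
    proof (rule Bochner_Integration.integrable_bound)
      show "integrable N (\<lambda>x. K * u x)" using u by simp
      show "AE x in N. norm (of_real (u x) / (c x - z)) \<le> norm (K * u x)"
      proof (rule AE_I2)
        fix x assume "x \<in> space N"
        then have "norm (1 / (c x - z)) \<le> K" using K cl by blast
        then have "\<bar>u x\<bar> * norm (1 / (c x - z)) \<le> \<bar>u x\<bar> * \<bar>K\<bar>" by (intro mult_left_mono) auto
        then show "norm (of_real (u x) / (c x - z)) \<le> norm (K * u x)"
          by (simp add: norm_divide norm_mult abs_mult mult.commute)
      qed
    qed measurable
  qed
  have R: "integrable N (\<lambda>x. Re (w x))" and I: "integrable N (\<lambda>x. Im (w x))" using w by auto
  let ?f = "\<lambda>u z x. of_real (max 0 (u x)) / (c x - z)"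
  show ?thesis
    unfolding cauchy_rep_def
  proof (intro exI conjI ballI)
    let ?ms = "[(1, D (\<lambda>x. Re (w x))), (-1, D (\<lambda>x. - Re (w x))), (\<i>, D (\<lambda>x. Im (w x))), (-\<i>, D (\<lambda>x. - Im (w x)))]"
    show "case m of (a, M) \<Rightarrow> finite_measure M \<and> sets M = sets ?X" if "m \<in> set ?ms" for m
      using that fin R I by (auto simp: D_def)
    fix z assume z: "z \<in> G"
    have m: "integrable N (?f u z)" if "integrable N u" for u
      using intg[of "\<lambda>x. max 0 (u x)"] that z by auto
    have "(\<Sum>(a, M)\<leftarrow>?ms. a * (LINT \<zeta>|M. 1 / (\<zeta> - z))) =
      (LINT x|N. ?f (\<lambda>x. Re (w x)) z x - ?f (\<lambda>x. - Re (w x)) z x + \<i> * ?f (\<lambda>x. Im (w x)) z x - \<i> * ?f (\<lambda>x. - Im (w x)) z x)"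
      using m[OF R] m[OF integrable_minus[OF R]] m[OF I] m[OF integrable_minus[OF I]]
      by (simp add: int[OF R] int[OF integrable_minus[OF R]] int[OF I] int[OF integrable_minus[OF I]] del: times_divide_eq_right)
    also have "\<dots> = (LINT x|N. w x / (c x - z))"
    proof (rule Bochner_Integration.integral_cong)
      fix x
      have "w x = of_real (max 0 (Re (w x))) - of_real (max 0 (- Re (w x))) + \<i> * of_real (max 0 (Im (w x))) - \<i> * of_real (max 0 (- Im (w x)))"
        by (auto simp: complex_eq_iff max_def)
      then have "w x / (c x - z) = (of_real (max 0 (Re (w x))) - of_real (max 0 (- Re (w x))) + \<i> * of_real (max 0 (Im (w x))) - \<i> * of_real (max 0 (- Im (w x)))) / (c x - z)"
        by (rule arg_cong)
      then show "?f (\<lambda>x. Re (w x)) z x - ?f (\<lambda>x. - Re (w x)) z x + \<i> * ?f (\<lambda>x. Im (w x)) z x - \<i> * ?f (\<lambda>x. - Im (w x)) z x = w x / (c x - z)"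
        by (simp add: diff_divide_distrib add_divide_distrib)
    qed simp
    finally show "(LINT x|N. w x / (c x - z)) = (\<Sum>(a, M)\<leftarrow>?ms. a * (LINT \<zeta>|M. 1 / (\<zeta> - z)))" ..
  qed
qed

section \<open>Growth of functions in Smirnov classes\<close>

lemma holomorphic_on_compose2:
  assumes "g holomorphic_on T" "f holomorphic_on S" "\<And>z. z \<in> S \<Longrightarrow> f z \<in> T"
  shows "(\<lambda>z. g (f z)) holomorphic_on S"
  using holomorphic_on_compose_gen[OF assms(2,1)] assms(3) by (auto simp: o_def)

text \<open>Cauchy's formula for U z times (r^2 - |w|^2) / (r^2 - cnj w z). The extra factor is
  holomorphic on the closed disc and equals 1 at w; on the circle r^2 = u cnj u turns its
  denominator into u (cnj u - cnj w), and combined with 1 / (u - w) this is the Poisson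
  kernel.\<close>

lemma poisson_formula:
  assumes hol: "U holomorphic_on cball 0 r" and w: "norm w < r"
  shows "((\<lambda>x. U (circlepath 0 r x) *
            of_real ((r\<^sup>2 - (norm w)\<^sup>2) / (norm (circlepath 0 r x - w))\<^sup>2)) has_integral U w) {0..1}"
proof -
  let ?c = "circlepath 0 r"
  have r: "0 < r" using w norm_ge_zero[of w] by linarith
  have nz: "of_real (r\<^sup>2) - cnj w * z \<noteq> 0" if "norm z \<le> r" for z :: complex
  proof
    assume "of_real (r\<^sup>2) - cnj w * z = 0"
    then have "of_real (r\<^sup>2) = cnj w * z" by simp
    then have "norm (of_real (r\<^sup>2) :: complex) = norm w * norm z"
      by (simp add: norm_mult)
    moreover have "norm w * norm z < r * r"
      using mult_left_mono[OF that norm_ge_zero[of w]] mult_strict_right_mono[OF w r] by linarith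
    ultimately show False by (simp add: power2_eq_square norm_mult)
  qed
  define V where "V = (\<lambda>z. U z * of_real (r\<^sup>2 - (norm w)\<^sup>2) / (of_real (r\<^sup>2) - cnj w * z))"
  have "V holomorphic_on cball 0 r"
    unfolding V_def by (intro holomorphic_intros hol) (use nz in auto)
  then have "((\<lambda>u. V u / (u - w)) has_contour_integral (2 * pi * \<i> * winding_number ?c w * V w)) ?c"
    by (rule Cauchy_integral_formula_convex_simple[OF convex_cball])
      (use w r in \<open>auto simp: path_image_circlepath\<close>)
  then have "((\<lambda>x. V (?c x) / (?c x - w) * vector_derivative ?c (at x within {0..1}))
      has_integral (2 * pi * \<i> * V w)) {0..1}"
    using w by (simp add: has_contour_integral_def winding_number_circlepath)
  then have "((\<lambda>x. V (?c x) / (?c x - w) * vector_derivative ?c (at x within {0..1}) / (2 * pi * \<i>))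
      has_integral (2 * pi * \<i> * V w / (2 * pi * \<i>))) {0..1}"
    by (rule has_integral_divide)
  moreover have "V w = U w"
  proof -
    have "cnj w * w = of_real ((norm w)\<^sup>2)"
      by (metis complex_norm_square mult.commute)
    moreover have "of_real (r\<^sup>2) - cnj w * w \<noteq> 0" using nz w by auto
    ultimately show ?thesis by (simp add: V_def)
  qed
  moreover have "V (?c x) / (?c x - w) * vector_derivative ?c (at x within {0..1}) / (2 * pi * \<i>) =
      U (?c x) * of_real ((r\<^sup>2 - (norm w)\<^sup>2) / (norm (?c x - w))\<^sup>2)" if "x \<in> {0..1}" for x
  proof -
    define u where "u = ?c x"
    have nu: "norm u = r" using r by (simp add: u_def circlepath norm_mult)
    have vd: "vector_derivative ?c (at x within {0..1}) = 2 * pi * \<i> * u"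
      using that vector_derivative_circlepath01[of x 0 r] unfolding u_def circlepath by simp
    have u: "of_real (r\<^sup>2) = u * cnj u"
      using nu by (metis complex_norm_square)
    have u0: "u \<noteq> 0" "u - w \<noteq> 0" "cnj u - cnj w \<noteq> 0" using nu r w by auto
    have n: "of_real ((norm (u - w))\<^sup>2) = (u - w) * (cnj u - cnj w)"
      by (metis complex_cnj_diff complex_norm_square)
    have "of_real (r\<^sup>2) - cnj w * u = u * (cnj u - cnj w)"
      unfolding u by (simp add: algebra_simps)
    then have "V u / (u - w) * (2 * pi * \<i> * u) / (2 * pi * \<i>) =
        U u * of_real (r\<^sup>2 - (norm w)\<^sup>2) / ((u - w) * (cnj u - cnj w))"
      using u0 by (simp add: V_def)
    then show ?thesis
      unfolding vd u_def[symmetric] of_real_divide n by simp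
  qed
  ultimately show ?thesis
    by (subst has_integral_cong[symmetric]) auto
qed

text \<open>Jensen's inequality for the Poisson kernel is replaced by the elementary
  \<open>x \<le> \<mu> + \<mu>\<^sup>1\<^sup>-\<^sup>p x\<^sup>p\<close> with a suitable constant \<open>\<mu>\<close>.\<close>

lemma hardy_pointwise_bound:
  fixes p M :: real
  assumes hol: "U holomorphic_on ball 0 1" and w: "norm w < 1" and p: "p > 1"
    and M: "\<And>r. 0 < r \<Longrightarrow> r < 1 \<Longrightarrow> r * integral {0..1} (\<lambda>x. norm (U (circlepath 0 r x)) powr p) \<le> M"
  shows "norm (U w) \<le> (1 + 8 * M) * (1 - norm w) powr (- 1 / p)"
proof -
  \<comment> \<open>The midpoint radius gives r - |w| = (1 - |w|) / 2, so the Poisson kernel is at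
    most 4 / (1 - |w|), and r \<ge> 1/2 lets the factor r in front of the mean be absorbed at the
    cost of a factor 2.\<close>
  define r where "r = (1 + norm w) / 2"
  have r: "norm w < r" "r < 1" "1/2 \<le> r" "0 < r"
    using w norm_ge_zero[of w] by (simp_all add: r_def del: norm_ge_zero)
  let ?c = "circlepath 0 r"
  define P where "P = (\<lambda>x. (r\<^sup>2 - (norm w)\<^sup>2) / (norm (?c x - w))\<^sup>2)"
  \<comment> \<open>The solution of \<mu>^(1-p) / (1 - |w|) = \<mu>: both terms of the elementary
    inequality then contribute the same power of 1 - |w|.\<close>
  define \<mu> where "\<mu> = (1 - norm w) powr (- 1 / p)"
  have lpos: "\<mu> > 0" using w by (simp add: \<mu>_def)
  have nc: "norm (?c x) = r" for x using r by (simp add: circlepath norm_mult)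
  have P0: "0 \<le> P x" for x
    unfolding P_def using power_mono[of "norm w" r 2] r by simp
  have P1: "P x \<le> 4 / (1 - norm w)" for x
  proof -
    have "r - norm w \<le> norm (?c x - w)"
      using norm_triangle_ineq2[of "?c x" w] nc by simp
    then have "(r - norm w)\<^sup>2 \<le> (norm (?c x - w))\<^sup>2"
      using r by (intro power_mono) auto
    moreover have "r\<^sup>2 - (norm w)\<^sup>2 = (r - norm w) * (r + norm w)"
      by (simp add: power2_eq_square algebra_simps)
    ultimately have "P x \<le> (r - norm w) * (r + norm w) / (r - norm w)\<^sup>2"
      unfolding P_def using r by (intro frac_le) auto
    also have "\<dots> = (r + norm w) / (r - norm w)"
      using r by (simp add: power2_eq_square)
    also have "\<dots> \<le> 2 / (r - norm w)"
      using r w by (intro divide_right_mono) auto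
    also have "\<dots> = 2 / ((1 - norm w) / 2)"
      by (simp add: r_def diff_divide_distrib add_divide_distrib)
    also have "\<dots> = 4 / (1 - norm w)" by simp
    finally show ?thesis .
  qed
  have sub: "cball 0 r \<subseteq> ball (0::complex) 1" using r by auto
  have hi: "((\<lambda>x. U (?c x) * of_real (P x)) has_integral U w) {0..1}"
    unfolding P_def by (rule poisson_formula[OF holomorphic_on_subset[OF hol sub] r(1)])
  have "((\<lambda>x. 1 * complex_of_real (P x)) has_integral 1) {0..1}"
    unfolding P_def by (rule poisson_formula[OF holomorphic_on_const r(1)])
  from has_integral_Re[OF this] have P_int: "(P has_integral 1) {0..1}" by simp
  have "continuous_on {0..1} (\<lambda>x. U (?c x))"
  proof (rule continuous_on_compose2[of "ball 0 1" U])
    show "continuous_on {0..1} ?c" unfolding circlepath by (intro continuous_intros)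
  qed (use hol holomorphic_on_imp_continuous_on nc r in auto)
  then have "(\<lambda>x. norm (U (?c x)) powr p) integrable_on {0..1}"
    using p by (intro integrable_continuous_interval continuous_on_powr' continuous_intros) auto
  then obtain I where I: "((\<lambda>x. norm (U (?c x)) powr p) has_integral I) {0..1}" by blast
  have "r * I \<le> M" using M[of r] r I by (simp add: integral_unique)
  moreover have I0: "0 \<le> I" using I by (rule has_integral_nonneg) auto
  moreover have "1 / 2 * I \<le> r * I" using I0 r(3) by (rule mult_right_mono[rotated])
  ultimately have IM: "I \<le> 2 * M" by linarith
  have g: "((\<lambda>x. \<mu> * P x + \<mu> powr (1 - p) * (4 / (1 - norm w)) * norm (U (?c x)) powr p) has_integral
      (\<mu> * 1 + \<mu> powr (1 - p) * (4 / (1 - norm w)) * I)) {0..1}"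
    by (intro has_integral_add has_integral_mult_right P_int I)
  have le: "norm (U (?c x) * of_real (P x)) \<le>
      \<mu> * P x + \<mu> powr (1 - p) * (4 / (1 - norm w)) * norm (U (?c x)) powr p" for x
  proof -
    define u where "u = norm (U (?c x))"
    have "u \<le> \<mu> + \<mu> powr (1 - p) * u powr p"
    proof (cases "u \<le> \<mu>")
      case True
      then show ?thesis by (simp add: add_increasing2)
    next
      case False
      then have "u > 0" using lpos by linarith
      have "u powr (1 - p) \<le> \<mu> powr (1 - p)"
        using False lpos p by (intro powr_mono2') auto
      then have "u powr (1 - p) * u powr p \<le> \<mu> powr (1 - p) * u powr p"
        by (rule mult_right_mono) simp
      moreover have "u powr (1 - p) * u powr p = u"
        using \<open>u > 0\<close> by (simp flip: powr_add)
      ultimately show ?thesis using lpos by linarith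
    qed
    then have "u * P x \<le> (\<mu> + \<mu> powr (1 - p) * u powr p) * P x"
      using P0 by (rule mult_right_mono)
    also have "\<dots> = \<mu> * P x + (\<mu> powr (1 - p) * u powr p) * P x"
      by (simp add: algebra_simps)
    also have "\<dots> \<le> \<mu> * P x + (\<mu> powr (1 - p) * u powr p) * (4 / (1 - norm w))"
      using P1 by (intro add_left_mono mult_left_mono) auto
    finally show ?thesis
      using P0[of x] by (simp add: u_def norm_mult mult_ac)
  qed
  have "norm (integral {0..1} (\<lambda>x. U (?c x) * of_real (P x))) \<le>
      integral {0..1} (\<lambda>x. \<mu> * P x + \<mu> powr (1 - p) * (4 / (1 - norm w)) * norm (U (?c x)) powr p)"
    using hi g le by (intro Henstock_Kurzweil_Integration.integral_norm_bound_integral) auto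
  then have "norm (U w) \<le> \<mu> + \<mu> powr (1 - p) * (4 / (1 - norm w)) * I"
    using integral_unique[OF hi] integral_unique[OF g] by simp
  also have "\<dots> \<le> \<mu> + \<mu> powr (1 - p) * (4 / (1 - norm w)) * (2 * M)"
    using IM w by (intro add_left_mono mult_left_mono) auto
  also have "\<mu> powr (1 - p) * (4 / (1 - norm w)) * (2 * M) = 8 * M * (\<mu> powr (1 - p) * (1 - norm w) powr (-1))"
    using w by (simp add: powr_minus_divide)
  also have "\<mu> powr (1 - p) * (1 - norm w) powr (-1) = \<mu>"
  proof -
    have "- 1 / p * (1 - p) + (-1) = - 1 / p" using p by (simp add: field_simps)
    then show ?thesis unfolding \<mu>_def powr_powr powr_add[symmetric] by simp
  qed
  finally show ?thesis by (simp add: \<mu>_def algebra_simps)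
qed

text \<open>The Schwarz lemma for the inverse of \<open>\<phi>\<close> on the disc of radius \<open>d\<close> around \<open>\<phi> w\<close>.\<close>

lemma conformal_radius_bound:
  assumes hol: "\<phi> holomorphic_on ball 0 1" and inj: "inj_on \<phi> (ball 0 1)"
    and w: "norm w < 1" and d: "d > 0" and sub: "ball (\<phi> w) d \<subseteq> \<phi> ` ball 0 1"
  shows "d \<le> (1 - (norm w)\<^sup>2) * norm (deriv \<phi> w)"
proof -
  obtain \<psi> where \<psi>: "\<psi> holomorphic_on (\<phi> ` ball 0 1)"
    "\<And>z. z \<in> ball 0 1 \<Longrightarrow> deriv \<phi> z * deriv \<psi> (\<phi> z) = 1"
    "\<And>z. z \<in> ball 0 1 \<Longrightarrow> \<psi> (\<phi> z) = z"
    using holomorphic_has_inverse[OF hol open_ball inj] by blast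
  have wb: "w \<in> ball 0 1" using w by simp
  \<comment> \<open>A self-map of the disc fixing 0: the affine map onto the disc around \<phi> w,
    then \<psi>, then the Moebius map sending w to 0. Its derivative at 0 is d \<psi>' / (1 -
    |w|^2), with \<psi>' taken at \<phi> w, where it is the reciprocal of \<phi>' w.\<close>
  define h where "h = (\<lambda>u. Moebius_function 0 w (\<psi> (\<phi> w + of_real d * u)))"
  have inb: "\<phi> w + of_real d * u \<in> \<phi> ` ball 0 1" if "norm u < 1" for u
    using sub that d by (intro subsetD[OF sub]) (auto simp: dist_norm norm_mult)
  have psib: "norm (\<psi> z) < 1" if "z \<in> \<phi> ` ball 0 1" for z
    using that \<psi>(3) by auto
  have h1: "((\<lambda>u. \<psi> (\<phi> w + of_real d * u)) holomorphic_on ball 0 1)"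
    using inb by (intro holomorphic_on_compose2[OF \<psi>(1)] holomorphic_intros) auto
  have "h holomorphic_on ball 0 1"
    unfolding h_def
    by (rule holomorphic_on_compose2[OF Moebius_function_holomorphic[OF w] h1]) (use inb psib in auto)
  moreover have "h 0 = 0"
    by (simp add: h_def \<psi>(3)[OF wb] Moebius_function_eq_zero)
  moreover have "norm (h u) < 1" if "norm u < 1" for u
    unfolding h_def using that w inb psib by (intro Moebius_function_norm_lt_1) auto
  ultimately have le: "norm (deriv h 0) \<le> 1"
    using Schwarz_Lemma(2)[of h 0] by simp
  have sq: "cnj w * w = of_real ((norm w)\<^sup>2)"
    by (metis complex_norm_square mult.commute)
  have n2: "(norm w)\<^sup>2 < 1" using w by (simp add: power_less_one_iff abs_square_less_1)
  then have nz: "1 - cnj w * w \<noteq> 0"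
    unfolding sq by (metis eq_iff_diff_eq_0 less_irrefl of_real_1 of_real_eq_iff)
  have "open (\<phi> ` ball 0 1)" by (rule open_mapping_thm3[OF hol open_ball inj])
  then have "(\<psi> has_field_derivative deriv \<psi> (\<phi> w)) (at (\<phi> w))"
    using \<psi>(1) wb by (intro holomorphic_derivI) auto
  then have "((\<lambda>u. \<psi> (\<phi> w + of_real d * u)) has_field_derivative deriv \<psi> (\<phi> w) * of_real d) (at 0)"
    by (intro DERIV_chain2) (auto intro!: derivative_eq_intros)
  moreover have "((\<lambda>z. (z - w) / (1 - cnj w * z)) has_field_derivative 1 / (1 - cnj w * w)) (at w)"
    using nz by (auto intro!: derivative_eq_intros simp: power2_eq_square)
  ultimately have "(h has_field_derivative 1 / (1 - cnj w * w) * (deriv \<psi> (\<phi> w) * of_real d)) (at 0)"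
    unfolding h_def Moebius_function_simple
    by (intro DERIV_chain2[where f = "\<lambda>z. (z - w) / (1 - cnj w * z)"]) (auto simp: \<psi>(3)[OF wb])
  then have "deriv h 0 = 1 / (1 - cnj w * w) * (deriv \<psi> (\<phi> w) * of_real d)"
    by (rule DERIV_imp_deriv)
  moreover have "norm (1 - cnj w * w) = 1 - (norm w)\<^sup>2"
  proof -
    have "1 - cnj w * w = of_real (1 - (norm w)\<^sup>2)" unfolding sq by simp
    then show ?thesis using n2 by (metis abs_of_pos diff_gt_0_iff_gt norm_of_real)
  qed
  ultimately have a: "norm (deriv \<psi> (\<phi> w)) * d \<le> 1 - (norm w)\<^sup>2"
    using le d n2 by (simp add: norm_mult norm_divide)
  have b: "norm (deriv \<phi> w) * norm (deriv \<psi> (\<phi> w)) = 1"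
    using \<psi>(2)[OF wb] by (metis norm_mult norm_one)
  have "d = norm (deriv \<phi> w) * (norm (deriv \<psi> (\<phi> w)) * d)" using b by (simp flip: mult.assoc)
  also have "\<dots> \<le> norm (deriv \<phi> w) * (1 - (norm w)\<^sup>2)" using a by (intro mult_left_mono) auto
  finally show ?thesis by (simp add: mult.commute)
qed

text \<open>The image of the circle is traversed with speed 2 pi r |\<phi>'|. The factor r is kept
  in front of the mean, which explains the form of the hypothesis of
  \<open>hardy_pointwise_bound\<close>.\<close>

lemma arc_length_integral_level_curve:
  assumes hol: "\<phi> holomorphic_on ball 0 1" and r: "0 < r" "r < 1"
  shows "arc_length_integral (\<phi> \<circ> circlepath 0 r) h =
    2 * pi * (r * integral {0..1} (\<lambda>x. h (\<phi> (circlepath 0 r x)) * norm (deriv \<phi> (circlepath 0 r x))))"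
proof -
  let ?c = "circlepath 0 r"
  have nc: "norm (?c x) = r" for x using r by (simp add: circlepath norm_mult)
  have "vector_derivative (\<phi> \<circ> ?c) (at x within {0..1}) =
      2 * pi * \<i> * r * exp (2 * of_real pi * \<i> * x) * deriv \<phi> (?c x)" if "x \<in> {0..1}" for x
  proof -
    have "((\<phi> \<circ> ?c) has_vector_derivative (2 * pi * \<i> * r * exp (2 * of_real pi * \<i> * x) * deriv \<phi> (?c x))) (at x)"
      by (rule field_vector_diff_chain_at[OF has_vector_derivative_circlepath])
        (use holomorphic_derivI[OF hol open_ball] nc r in auto)
    then show ?thesis
      using that by (simp add: vector_derivative_at_within_ivl)
  qed
  then have "arc_length_integral (\<phi> \<circ> ?c) h =
      integral {0..1} (\<lambda>x. (2 * pi * r) * (h (\<phi> (?c x)) * norm (deriv \<phi> (?c x))))"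
    unfolding arc_length_integral_def using r
    by (intro integral_cong) (simp add: norm_mult)
  then show ?thesis by simp
qed

text \<open>Stated for every d whose ball fits into G instead of the distance to the frontier, so
  that it applies directly to the explicit radii \<open>\<kappa> * t\<close> of the collar.\<close>

lemma smirnov_pointwise_bound:
  fixes p :: ereal
  assumes conf: "conformal_onto \<phi> (ball 0 1) G" and p: "1 < p" and bG: "bounded G"
    and g: "g \<in> smirnov_class \<phi> G p"
  obtains C b :: real where "0 \<le> C" "0 < b" "b < 1"
    "\<And>z d. z \<in> G \<Longrightarrow> 0 < d \<Longrightarrow> ball z d \<subseteq> G \<Longrightarrow> norm (g z) \<le> C * d powr (- b)"
proof (cases "p = \<infinity>")
  case True
  then obtain K where K: "\<And>z. z \<in> G \<Longrightarrow> norm (g z) \<le> K"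
    using g by (auto simp: smirnov_class_def bounded_iff)
  obtain R where R: "\<And>z. z \<in> G \<Longrightarrow> norm z \<le> R" "R > 0"
    using bG bounded_pos by blast
  \<comment> \<open>For bounded g any exponent in (0, 1) would serve; 1/2 is taken. The point z +
    d/2 of G forces d \<le> 4 R, hence (4 R / d)^(1/2) \<ge> 1.\<close>
  have "norm (g z) \<le> (\<bar>K\<bar> * (4 * R) powr (1/2)) * d powr (- (1/2))"
    if z: "z \<in> G" and d: "0 < d" "ball z d \<subseteq> G" for z d
  proof -
    have "z + of_real (d/2) \<in> G" using d by (intro subsetD[OF d(2)]) (auto simp: dist_norm)
    then have "norm ((z + of_real (d/2)) - z) \<le> R + R"
      using R(1) z by (intro order_trans[OF norm_triangle_ineq4] add_mono)
    then have "d \<le> 4 * R" using d by simp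
    then have "1 \<le> (4 * R / d) powr (1/2)" using d R(2) by (intro ge_one_powr_ge_zero) auto
    also have "\<dots> = (4 * R) powr (1/2) * d powr (- (1/2))"
      using d R(2) by (simp add: powr_divide powr_minus_divide)
    finally have "\<bar>K\<bar> * 1 \<le> \<bar>K\<bar> * ((4 * R) powr (1/2) * d powr (- (1/2)))"
      by (rule mult_left_mono) simp
    then show ?thesis using K[OF z] by (simp add: mult.assoc)
  qed
  then show ?thesis by (intro that[of "\<bar>K\<bar> * (4 * R) powr (1/2)" "1/2"]) auto
next
  case False
  then obtain q where q: "p = ereal q" "q > 1" using p by (cases p) auto
  have hol: "\<phi> holomorphic_on ball 0 1" and inj: "inj_on \<phi> (ball 0 1)" and img: "\<phi> ` ball 0 1 = G"
    using conf by (auto simp: conformal_onto_def)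
  have gh: "g holomorphic_on G" using g by (simp add: smirnov_class_def)
  define A where "A = (\<lambda>r. 1 / (2 * pi) * arc_length_integral (\<phi> \<circ> circlepath 0 r) (\<lambda>\<zeta>. norm (g \<zeta>) powr q))"
  have "bdd_above (A ` {0<..<1})"
    using g False q by (simp add: smirnov_class_def A_def)
  then obtain M where "\<forall>r\<in>{0<..<1}. A r \<le> M"
    by (auto simp: bdd_above_def)
  then have M: "1 / (2 * pi) * arc_length_integral (\<phi> \<circ> circlepath 0 r) (\<lambda>\<zeta>. norm (g \<zeta>) powr q) \<le> M"
    if "0 < r" "r < 1" for r
    using that by (simp add: A_def)
  have nz: "deriv \<phi> z \<noteq> 0" if "z \<in> ball 0 1" for z
    using holomorphic_injective_imp_regular[OF hol open_ball inj that] .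
  have "deriv \<phi> holomorphic_on ball 0 1" by (rule holomorphic_deriv[OF hol open_ball])
  then obtain L where L: "L holomorphic_on ball 0 1" "\<And>z. z \<in> ball 0 1 \<Longrightarrow> deriv \<phi> z = exp (L z)"
    using contractible_imp_holomorphic_log[of "deriv \<phi>" "ball 0 1"] nz
      convex_imp_contractible convex_ball by metis
  \<comment> \<open>The logarithm \<open>L\<close> of \<phi>' provides a holomorphic branch of its
    power 1/q, so that |U|^q is the integrand of the Smirnov condition pulled back to the
    disc.\<close>
  define U where "U = (\<lambda>z. g (\<phi> z) * exp (L z / of_real q))"
  have "(\<lambda>z. g (\<phi> z)) holomorphic_on ball 0 1"
    using img by (intro holomorphic_on_compose2[OF gh hol]) auto
  then have Uh: "U holomorphic_on ball 0 1"
    unfolding U_def using q by (intro holomorphic_intros L) auto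
  have ne: "norm (exp (L z / of_real q)) = norm (deriv \<phi> z) powr (1 / q)" if "z \<in> ball 0 1" for z
    using L(2)[OF that] q by (simp add: norm_exp_eq_Re exp_powr_real)
  have Up: "norm (U z) powr q = norm (g (\<phi> z)) powr q * norm (deriv \<phi> z)" if "z \<in> ball 0 1" for z
    using q ne[OF that] by (simp add: U_def norm_mult powr_mult powr_powr)
  have MU: "r * integral {0..1} (\<lambda>x. norm (U (circlepath 0 r x)) powr q) \<le> M" if r: "0 < r" "r < 1" for r
  proof -
    have "integral {0..1} (\<lambda>x. norm (U (circlepath 0 r x)) powr q) =
        integral {0..1} (\<lambda>x. norm (g (\<phi> (circlepath 0 r x))) powr q * norm (deriv \<phi> (circlepath 0 r x)))"
      using r by (intro integral_cong Up) (simp add: circlepath norm_mult)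
    then show ?thesis
      using M[OF r] unfolding arc_length_integral_level_curve[OF hol r] by simp
  qed
  \<comment> \<open>\<open>integral\<close> is 0 for a function that is not integrable, so the mean
    is nonnegative in either case; r = 1/2 then yields M \<ge> 0, on which the sign of the constant
    below depends.\<close>
  have "r * integral {0..1} (\<lambda>x. norm (U (circlepath 0 r x)) powr q) \<ge> 0" if "r > 0" for r
    by (cases "(\<lambda>x. norm (U (circlepath 0 r x)) powr q) integrable_on {0..1}")
      (use that in \<open>auto intro!: mult_nonneg_nonneg integral_nonneg simp: not_integrable_integral\<close>)
  from order_trans[OF this MU, of "1/2"] have M0: "0 \<le> M" by simp
  have "norm (g z) \<le> ((1 + 8 * M) * (1/2) powr (- 1 / q)) * d powr (- (1 / q))"
    if z: "z \<in> G" and d: "0 < d" "ball z d \<subseteq> G" for z d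
  proof -
    obtain w where w: "norm w < 1" "z = \<phi> w" using z img by auto
    have wb: "w \<in> ball 0 1" using w by simp
    let ?D = "norm (deriv \<phi> w)"
    have D: "?D > 0" using nz[OF wb] by simp
    have "d \<le> (1 - (norm w)\<^sup>2) * ?D"
      using conformal_radius_bound[OF hol inj w(1) d(1)] d img w by simp
    also have "1 - (norm w)\<^sup>2 = (1 - norm w) * (1 + norm w)"
      by (simp add: power2_eq_square algebra_simps)
    also have "(1 - norm w) * (1 + norm w) * ?D \<le> (1 - norm w) * 2 * ?D"
      using w by (intro mult_right_mono mult_left_mono) auto
    finally have "d \<le> 2 * ((1 - norm w) * ?D)" by (simp only: mult_ac)
    then have d2: "1 / 2 * d \<le> (1 - norm w) * ?D" by linarith
    have "norm (U w) \<le> (1 + 8 * M) * (1 - norm w) powr (- 1 / q)"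
      by (rule hardy_pointwise_bound[OF Uh w(1) q(2) MU])
    then have "norm (g z) * ?D powr (1 / q) \<le> (1 + 8 * M) * (1 - norm w) powr (- 1 / q)"
      using ne[OF wb] w by (simp add: U_def norm_mult)
    then have "norm (g z) * ?D powr (1 / q) * ?D powr (- 1 / q) \<le>
        (1 + 8 * M) * (1 - norm w) powr (- 1 / q) * ?D powr (- 1 / q)"
      by (rule mult_right_mono) simp
    moreover have "?D powr (1 / q) * ?D powr (- 1 / q) = 1"
      using D by (simp flip: powr_add)
    ultimately have "norm (g z) \<le> (1 + 8 * M) * (1 - norm w) powr (- 1 / q) * ?D powr (- 1 / q)"
      by (simp only: mult.assoc mult_1_right)
    also have "\<dots> = (1 + 8 * M) * ((1 - norm w) * ?D) powr (- 1 / q)"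
      using w by (simp add: powr_mult)
    also have "\<dots> \<le> (1 + 8 * M) * (1 / 2 * d) powr (- 1 / q)"
      using d2 d q M0 by (intro mult_left_mono powr_mono2') auto
    also have "\<dots> = ((1 + 8 * M) * (1/2) powr (- 1 / q)) * d powr (- (1 / q))"
      using d by (subst powr_mult) auto
    finally show ?thesis .
  qed
  then show ?thesis using M0 q by (intro that[of "(1 + 8 * M) * (1/2) powr (- 1 / q)" "1/q"]) auto
qed

section \<open>Smooth closed curves\<close>

lemma periodic_add_of_int:
  fixes g :: "real \<Rightarrow> 'a"
  assumes "\<And>x. g (x + 1) = g x"
  shows "g (x + of_int k) = g x"
proof -
  have nat: "g (x + of_nat n) = g x" for x n
  proof (induction n)
    case (Suc n)
    then show ?case using assms[of "x + of_nat n"] by (simp add: algebra_simps)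
  qed simp
  show ?thesis
  proof (cases "k \<ge> 0")
    case True
    then show ?thesis using nat[of x "nat k"] by simp
  next
    case False
    then show ?thesis using nat[of "x + of_int k" "nat (- k)"] by simp
  qed
qed

text \<open>Scaled to period 1 and constant speed L: c is then itself a path over {0..1}, as winding
  numbers and contour integrals require, and the parameters of one point differ by integers.\<close>

locale smooth_loop =
  fixes c c' :: "real \<Rightarrow> complex" and L :: real
  assumes periodic: "c (x + 1) = c x"
    and has_derivative: "(c has_vector_derivative c' x) (at x)"
    and continuous_derivative: "continuous_on UNIV c'"
    and speed: "norm (c' x) = L"
    and L_pos: "L > 0"
    and inj: "inj_on c {0..<1}"
begin

lemmas periodic_int = periodic_add_of_int[of c, OF periodic]

lemma derivative_periodic: "c' (x + 1) = c' x"
proof -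
  have "((\<lambda>x. c (x + 1)) has_vector_derivative c' (x + 1)) (at x)"
    using vector_diff_chain_at[of "\<lambda>x. x + 1" 1 x c "c' (x + 1)"] has_derivative[of "x + 1"]
    by (simp add: o_def has_vector_derivative_add_const)
  then have "(c has_vector_derivative c' (x + 1)) (at x)" using periodic by simp
  then show ?thesis using has_derivative vector_derivative_unique_at by blast
qed

lemmas derivative_periodic_int = periodic_add_of_int[of c', OF derivative_periodic]

lemma continuous: "continuous_on S c"
  by (rule continuous_at_imp_continuous_on) (rule ballI has_vector_derivative_continuous[OF has_derivative])+

lemma eq_frac: "c (frac x) = c x"
  using periodic_int[of "frac x" "floor x"] by (simp add: frac_def)

lemma range_eq: "range c = c ` {0..<1}"
proof
  show "range c \<subseteq> c ` {0..<1}"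
  proof
    fix z assume "z \<in> range c"
    then obtain x where "z = c (frac x)" using eq_frac by (metis imageE)
    then show "z \<in> c ` {0..<1}" using frac_ge_0[of x] frac_lt_1[of x] by (intro image_eqI) auto
  qed
qed auto

lemma compact_range: "compact (range c)"
proof -
  have "c ` {0..<1} \<subseteq> c ` {0..1}" by (intro image_mono) auto
  then have "range c = c ` {0..1}" using range_eq by blast
  then show ?thesis by (simp add: compact_continuous_image continuous)
qed

lemma eq_imp_int:
  assumes "c x = c y"
  shows "x = y + of_int (floor x - floor y)"
proof -
  have "c (frac x) = c (frac y)" using assms eq_frac by metis
  then have "frac x = frac y"
    using inj frac_ge_0 frac_lt_1 by (auto dest!: inj_onD)
  then show ?thesis by (simp add: frac_def algebra_simps)
qed

lemma eq_imp_eq: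
  assumes "c x = c y" "\<bar>x - y\<bar> \<le> 1/2"
  shows "x = y"
proof -
  have "x - y = of_int (floor x - floor y)" using eq_imp_int[OF assms(1)] by simp
  moreover from this have "floor x - floor y = 0" using assms(2) by linarith
  ultimately show ?thesis by simp
qed

text \<open>Neighbouring points may have distant parameters, for instance across the base point.
  Passing to y' makes |x - y'| the distance on the circle of parameters, for which the chord
  estimates are stated.\<close>

lemma near_representative: "\<exists>y'. c y' = c y \<and> \<bar>x - y'\<bar> \<le> 1/2"
proof -
  have "\<bar>of_int (round (x - y)) - (x - y)\<bar> \<le> 1/2" by (rule of_int_round_abs_le)
  then have "\<bar>x - (y + of_int (round (x - y)))\<bar> \<le> 1/2" by linarith
  then show ?thesis using periodic_int by blast
qed

section \<open>Uniform linear approximation and transversals of the curve\<close>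

lemma derivative_uniform:
  assumes e: "e > 0"
  obtains \<delta> where "\<delta> > 0" "\<And>x y. \<bar>x - y\<bar> < \<delta> \<Longrightarrow> norm (c' x - c' y) < e"
proof -
  have "uniformly_continuous_on {-1..2} c'"
    using continuous_derivative by (intro compact_uniformly_continuous) (auto intro: continuous_on_subset)
  then obtain d where d: "d > 0" "\<And>x y. x \<in> {-1..2} \<Longrightarrow> y \<in> {-1..2} \<Longrightarrow> dist y x < d \<Longrightarrow> dist (c' y) (c' x) < e"
    unfolding uniformly_continuous_on_def using e by blast
  show ?thesis
  \<comment> \<open>The cap 1 keeps both parameters in {-1..2} once x has been shifted into {0..1},
    so uniform continuity on one compact interval suffices.\<close>
  proof (rule that[of "min d 1"])
    fix x y :: real assume "\<bar>x - y\<bar> < min d 1"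
    then have "dist (c' (y + of_int (- floor x))) (c' (x + of_int (- floor x))) < e"
      by (intro d(2)) (auto simp: dist_real_def abs_if split: if_splits, linarith+)
    then show "norm (c' x - c' y) < e"
      unfolding derivative_periodic_int by (simp add: dist_norm norm_minus_commute)
  qed (use d in auto)
qed

lemma linear_approx:
  assumes e: "e > 0"
  obtains \<delta> where "\<delta> > 0" "\<And>x y. \<bar>x - y\<bar> < \<delta> \<Longrightarrow> norm (c y - c x - of_real (y - x) * c' x) \<le> e * \<bar>y - x\<bar>"
proof -
  obtain \<delta> where \<delta>: "\<delta> > 0" "\<And>x y. \<bar>x - y\<bar> < \<delta> \<Longrightarrow> norm (c' x - c' y) < e"
    using derivative_uniform[OF e] by blast
  have "norm (c y - c x - of_real (y - x) * c' x) \<le> e * \<bar>y - x\<bar>" if "\<bar>x - y\<bar> < \<delta>" for x y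
  proof -
    have "norm (c y - c x - (y - x) *\<^sub>R c' x) \<le> norm (y - x) * e"
    proof (rule vector_differentiable_bound_linearization[where S = "closed_segment x y"])
      show "norm (c' t - c' x) \<le> e" if "t \<in> closed_segment x y" for t
        using that \<open>\<bar>x - y\<bar> < \<delta>\<close>
        by (intro less_imp_le \<delta>) (auto simp: closed_segment_eq_real_ivl split: if_splits)
    qed (auto intro: has_vector_derivative_at_within has_derivative)
    then show ?thesis by (simp add: scaleR_conv_of_real mult.commute)
  qed
  with \<delta> show ?thesis using that by blast
qed

text \<open>For close parameters c x + t v - c y is ((x - y) + \<i> t) c' x up to errors L/10 |x -
  y| and L/10 |t|, while the main term is at least L/2 (|x - y| + |t|). For distant ones injectivity
  and compactness bound the chord below by \<open>m\<close>, and t is too small to compensate it.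
  The tolerance L/10 leaves room for fields other than the normal.\<close>

lemma transversal_estimate:
  obtains t\<^sub>0 \<kappa> where "0 < t\<^sub>0" "0 < \<kappa>"
    "\<And>x y t v. \<bar>x - y\<bar> \<le> 1/2 \<Longrightarrow> \<bar>t\<bar> \<le> t\<^sub>0 \<Longrightarrow> norm (v - \<i> * c' x) \<le> L / 10 \<Longrightarrow>
       \<kappa> * (\<bar>t\<bar> + \<bar>x - y\<bar>) \<le> norm (c x + of_real t * v - c y)"
proof -
  obtain \<delta> where \<delta>: "\<delta> > 0"
    "\<And>x y. \<bar>x - y\<bar> < \<delta> \<Longrightarrow> norm (c y - c x - of_real (y - x) * c' x) \<le> L / 10 * \<bar>y - x\<bar>"
    using linear_approx[of "L / 10"] L_pos by auto
  \<comment> \<open>By periodicity it is enough to treat x in {0..1}, which makes the set of distant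
    pairs compact.\<close>
  define K where "K = {(x, y). x \<in> {0..1} \<and> \<delta> \<le> \<bar>x - y\<bar> \<and> \<bar>x - y\<bar> \<le> 1/2}"
  have "closed K"
    unfolding K_def case_prod_beta' mem_Collect_eq atLeastAtMost_iff
    by (intro closed_Collect_conj closed_Collect_le continuous_intros)
  have "K \<subseteq> {0..1} \<times> {-1..2}"
  proof
    fix p assume "p \<in> K"
    then obtain x y where "p = (x, y)" "0 \<le> x" "x \<le> 1" "\<bar>x - y\<bar> \<le> 1/2" by (auto simp: K_def)
    moreover from this have "-1 \<le> y" "y \<le> 2" by linarith+
    ultimately show "p \<in> {0..1} \<times> {-1..2}" by simp
  qed
  then have "({0..1} \<times> {-1..2}) \<inter> K = K" by blast
  moreover have "compact (({0..1} \<times> {-1..2}) \<inter> K)"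
    using \<open>closed K\<close> by (intro compact_Int_closed compact_Times) auto
  ultimately have "compact K" by simp
  moreover have "continuous_on K (\<lambda>p. c (fst p) - c (snd p))"
    by (intro continuous_intros continuous_on_compose2[OF continuous[of UNIV]]) auto
  ultimately have "closed ((\<lambda>p. c (fst p) - c (snd p)) ` K)"
    by (intro compact_imp_closed compact_continuous_image)
  moreover have "0 \<notin> (\<lambda>p. c (fst p) - c (snd p)) ` K"
    using eq_imp_eq \<delta>(1) by (fastforce simp: K_def)
  ultimately obtain m where m: "m > 0" "\<And>p. p \<in> K \<Longrightarrow> m \<le> norm (c (fst p) - c (snd p))"
    using separate_point_closed[of "(\<lambda>p. c (fst p) - c (snd p)) ` K" 0] by (auto simp: dist_norm)
  have far: "m \<le> norm (c x - c y)" if "\<delta> \<le> \<bar>x - y\<bar>" "\<bar>x - y\<bar> \<le> 1/2" for x y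
  proof -
    have "m \<le> norm (c (x + of_int (- floor x)) - c (y + of_int (- floor x)))"
      using m(2)[of "(x + of_int (- floor x), y + of_int (- floor x))"] that
      by (simp add: K_def) linarith
    then show ?thesis unfolding periodic_int .
  qed
  define t\<^sub>0 where "t\<^sub>0 = min 1 (m / (4 * L))"
  \<comment> \<open>Since |v| \<le> 2 L, the choice of \<open>t\<^sub>0\<close> gives |t v| \<le>
    m/2, and its cap 1 gives |t| + |x - y| \<le> 2. Thus m/4 suits distant parameters, and L/4 lies
    below the constant L/2 - L/10 for close ones.\<close>
  define \<kappa> where "\<kappa> = min (L / 4) (m / 4)"
  have "\<kappa> * (\<bar>t\<bar> + \<bar>x - y\<bar>) \<le> norm (c x + of_real t * v - c y)"
    if xy: "\<bar>x - y\<bar> \<le> 1/2" and t: "\<bar>t\<bar> \<le> t\<^sub>0" and v: "norm (v - \<i> * c' x) \<le> L / 10" for x y t v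
  proof (cases "\<bar>x - y\<bar> < \<delta>")
    case True
    have r: "(\<bar>x - y\<bar> + \<bar>t\<bar>) / 2 \<le> norm (of_real (x - y) + \<i> * of_real t :: complex)"
      using abs_Re_le_cmod[of "of_real (x - y) + \<i> * of_real t"] abs_Im_le_cmod[of "of_real (x - y) + \<i> * of_real t"]
      by simp
    have "L * ((\<bar>x - y\<bar> + \<bar>t\<bar>) / 2) \<le> norm ((of_real (x - y) + \<i> * of_real t) * c' x)"
      using mult_left_mono[OF r, of L] L_pos by (simp add: norm_mult speed mult.commute)
    also have "(of_real (x - y) + \<i> * of_real t) * c' x =
       (c x + of_real t * v - c y) + (c y - c x - of_real (y - x) * c' x) - of_real t * (v - \<i> * c' x)"
      by (simp add: algebra_simps)
    also have "norm \<dots> \<le> norm (c x + of_real t * v - c y) + norm (c y - c x - of_real (y - x) * c' x) + norm (of_real t * (v - \<i> * c' x))"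
      by (meson add_mono norm_triangle_ineq norm_triangle_ineq4 order_refl order_trans)
    also have "\<dots> \<le> norm (c x + of_real t * v - c y) + L / 10 * \<bar>y - x\<bar> + \<bar>t\<bar> * (L / 10)"
      using \<delta>(2)[OF True] mult_left_mono[OF v abs_ge_zero[of t]] by (intro add_mono) (simp_all add: norm_mult)
    finally have "L * ((\<bar>x - y\<bar> + \<bar>t\<bar>) / 2) - L / 10 * (\<bar>x - y\<bar> + \<bar>t\<bar>) \<le> norm (c x + of_real t * v - c y)"
      by (simp add: algebra_simps abs_minus_commute)
    moreover have "\<kappa> * (\<bar>t\<bar> + \<bar>x - y\<bar>) \<le> L / 4 * (\<bar>t\<bar> + \<bar>x - y\<bar>)"
      by (intro mult_right_mono) (auto simp: \<kappa>_def)
    moreover have "L / 4 * (\<bar>t\<bar> + \<bar>x - y\<bar>) \<le> 2 * L / 5 * (\<bar>t\<bar> + \<bar>x - y\<bar>)"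
      using L_pos by (intro mult_right_mono) auto
    moreover have "L * ((\<bar>x - y\<bar> + \<bar>t\<bar>) / 2) - L / 10 * (\<bar>x - y\<bar> + \<bar>t\<bar>) = 2 * L / 5 * (\<bar>t\<bar> + \<bar>x - y\<bar>)"
      by (simp add: field_simps)
    ultimately show ?thesis by linarith
  next
    case False
    have "norm v \<le> norm (\<i> * c' x) + norm (v - \<i> * c' x)" by (rule norm_triangle_sub)
    also have "\<dots> \<le> 2 * L" using v L_pos by (simp add: norm_mult speed)
    finally have "\<bar>t\<bar> * norm v \<le> t\<^sub>0 * (2 * L)" using t by (intro mult_mono) auto
    also have "\<dots> \<le> m / (4 * L) * (2 * L)" unfolding t\<^sub>0_def using L_pos by (intro mult_right_mono) auto
    also have "\<dots> = m / 2" using L_pos by simp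
    finally have tv: "norm (of_real t * v) \<le> m / 2" by (simp add: norm_mult)
    have "m \<le> norm (c x - c y)" using far False xy by simp
    also have "c x - c y = (c x + of_real t * v - c y) - of_real t * v" by simp
    also have "norm \<dots> \<le> norm (c x + of_real t * v - c y) + norm (of_real t * v)" by (rule norm_triangle_ineq4)
    finally have "m / 2 \<le> norm (c x + of_real t * v - c y)" using tv by linarith
    moreover have "\<kappa> * (\<bar>t\<bar> + \<bar>x - y\<bar>) \<le> m / 4 * 2"
      using xy t m L_pos by (intro mult_mono) (auto simp: \<kappa>_def t\<^sub>0_def)
    ultimately show ?thesis by linarith
  qed
  moreover have "0 < t\<^sub>0" "0 < \<kappa>" using m L_pos by (auto simp: t\<^sub>0_def \<kappa>_def)
  ultimately show ?thesis using that by blast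
qed

text \<open>A point of \<open>G\<close> near the curve lies on the normal through a nearest point of the curve. So \<open>G\<close>
  meets one of the two connected one-sided neighbourhoods of the curve, and contains it since they do
  not meet the frontier.\<close>

lemma one_sided_neighbourhood:
  assumes G: "open G" "frontier G = range c" "G \<noteq> {}"
    and t0: "0 < t\<^sub>0" and k0: "0 < \<kappa>"
    and est: "\<And>x y t v. \<bar>x - y\<bar> \<le> 1/2 \<Longrightarrow> \<bar>t\<bar> \<le> t\<^sub>0 \<Longrightarrow> norm (v - \<i> * c' x) \<le> L / 10 \<Longrightarrow>
       \<kappa> * (\<bar>t\<bar> + \<bar>x - y\<bar>) \<le> norm (c x + of_real t * v - c y)"
  obtains \<sigma> :: real where "\<bar>\<sigma>\<bar> = 1"
    "\<And>x t v. 0 < t \<Longrightarrow> t \<le> t\<^sub>0 \<Longrightarrow> norm (v - \<i> * c' x) \<le> L / 10 \<Longrightarrow> c x + of_real (\<sigma> * t) * v \<in> G"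
proof -
  \<comment> \<open>The domain is convex, so the image is connected. The perturbation u is built in
    so that every field within L/10 of the normal, and not just the normal, leads into G.\<close>
  define S where "S = (\<lambda>\<sigma>::real. (\<lambda>(x, t, u). c x + of_real (\<sigma> * t) * (\<i> * c' x + u)) ` (UNIV \<times> {0<..t\<^sub>0} \<times> cball 0 (L / 10)))"
  have SI: "c x + of_real (\<sigma> * t) * v \<in> S \<sigma>"
    if "0 < t" "t \<le> t\<^sub>0" "norm (v - \<i> * c' x) \<le> L / 10" for x t v \<sigma>
    unfolding S_def using that by (intro image_eqI[of _ _ "(x, t, v - \<i> * c' x)"]) auto
  have conn: "connected (S \<sigma>)" for \<sigma>
    unfolding S_def case_prod_beta'
  proof (rule connected_continuous_image)
    show "continuous_on (UNIV \<times> {0<..t\<^sub>0} \<times> cball 0 (L / 10))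
        (\<lambda>p. c (fst p) + of_real (\<sigma> * fst (snd p)) * (\<i> * c' (fst p) + snd (snd p)))"
      by (intro continuous_intros continuous_on_compose2[OF continuous[of UNIV]]
          continuous_on_compose2[OF continuous_derivative]) auto
    show "connected ((UNIV::real set) \<times> {0<..t\<^sub>0} \<times> cball (0::complex) (L / 10))"
      by (intro convex_connected convex_Times) auto
  qed
  have avoid: "S \<sigma> \<inter> range c = {}" if \<sigma>: "\<bar>\<sigma>\<bar> = 1" for \<sigma>
  proof -
    have False if h: "0 < t" "t \<le> t\<^sub>0" "norm u \<le> L / 10" "c x + of_real (\<sigma> * t) * (\<i> * c' x + u) = c y" for x t u y
    proof -
      obtain y' where y': "c y' = c y" "\<bar>x - y'\<bar> \<le> 1/2" using near_representative by blast
      have "\<kappa> * (\<bar>\<sigma> * t\<bar> + \<bar>x - y'\<bar>) \<le> norm (c x + of_real (\<sigma> * t) * (\<i> * c' x + u) - c y')"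
        using h \<sigma> by (intro est y') (auto simp: abs_mult)
      also have "\<dots> = 0" using h y' by simp
      finally have "\<bar>\<sigma> * t\<bar> + \<bar>x - y'\<bar> \<le> 0" using k0 by (simp add: mult_le_0_iff)
      then show False using h \<sigma> by (simp add: abs_mult)
    qed
    then show ?thesis by (auto simp: S_def)
  qed
  have inside: "S \<sigma> \<subseteq> G" if "\<bar>\<sigma>\<bar> = 1" "S \<sigma> \<inter> G \<noteq> {}" for \<sigma>
    using connected_Int_frontier[OF conn[of \<sigma>], of G] that avoid[OF that(1)] G by auto
  have disj: "G \<inter> range c = {}" using G by (metis frontier_disjoint_eq Int_commute)
  \<comment> \<open>The normal \<i> c' y has length L, so a distance below \<open>t\<^sub>0\<close>
    L to the nearest point means a normal coordinate of modulus at most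
    \<open>t\<^sub>0\<close>.\<close>
  obtain g where g: "g \<in> G" "dist g (c 0) < t\<^sub>0 * L"
  proof -
    have "c 0 \<in> closure G" using G(2) by (auto simp: frontier_def)
    then show ?thesis using that t0 L_pos by (metis closure_approachable mult_pos_pos)
  qed
  note compact_range
  moreover have "range c \<noteq> {}" by simp
  ultimately obtain z where "z \<in> range c" "\<And>w. w \<in> range c \<Longrightarrow> dist g z \<le> dist g w"
    by (rule distance_attains_inf[OF compact_imp_closed, where a = g]) blast
  then obtain y where y: "\<And>x. dist g (c y) \<le> dist g (c x)"
    by auto
  define D where "D = g - c y"
  have "D \<noteq> 0" using g disj by (auto simp: D_def)
  have "norm D \<le> dist g (c 0)" using y by (simp add: D_def dist_norm)
  then have Dn: "norm D < t\<^sub>0 * L" using g by linarith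
  have "((\<lambda>x. (g - c x) \<bullet> (g - c x)) has_derivative (\<lambda>h. - 2 * h * (D \<bullet> c' y))) (at y)"
    using has_derivative[of y] unfolding has_vector_derivative_def
    by (auto intro!: derivative_eq_intros simp: D_def inner_commute algebra_simps)
  then have "(\<lambda>h. - 2 * h * (D \<bullet> c' y)) = (\<lambda>h. 0)"
    by (rule has_derivative_local_min)
      (use y in \<open>auto simp: dist_norm norm_eq_sqrt_inner\<close>)
  then have perp: "D \<bullet> c' y = 0" by (metis mult_eq_0_iff mult_1_right neg_equal_0_iff_equal zero_neq_numeral)
  have cy: "c' y \<noteq> 0" using speed[of y] L_pos by auto
  define \<tau> where "\<tau> = Im (D / c' y)"
  have "Re (D / c' y) = 0"
    using perp by (simp add: Re_divide inner_complex_def)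
  then have "D / c' y = \<i> * of_real \<tau>" by (simp add: complex_eq_iff \<tau>_def)
  then have D: "D = of_real \<tau> * (\<i> * c' y)" using cy by (simp add: field_simps)
  then have "norm D = \<bar>\<tau>\<bar> * L" by (simp add: norm_mult speed)
  with Dn \<open>D \<noteq> 0\<close> L_pos have \<tau>: "\<bar>\<tau>\<bar> \<le> t\<^sub>0" "\<tau> \<noteq> 0" by (auto simp: D)
  define \<sigma> where "\<sigma> = sgn \<tau>"
  have ts: "\<sigma> * \<bar>\<tau>\<bar> = \<tau>" by (simp add: \<sigma>_def sgn_mult_abs)
  have "g = c y + of_real (\<sigma> * \<bar>\<tau>\<bar>) * (\<i> * c' y)"
    unfolding ts using D by (simp add: D_def algebra_simps)
  then have "g \<in> S \<sigma>" using \<tau> L_pos by (metis SI norm_zero cancel_comm_monoid_add_class.diff_cancel divide_nonneg_nonneg less_imp_le zero_less_abs_iff zero_le_numeral)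
  moreover have s1: "\<bar>\<sigma>\<bar> = 1" using \<tau> by (simp add: \<sigma>_def sgn_if)
  ultimately have "S \<sigma> \<subseteq> G" using inside g by auto
  then show ?thesis using SI that[OF s1] by blast
qed

text \<open>The unit normal is only continuous. Replacing the tangent by a difference quotient of \<open>c\<close>
  gives a transversal field with a derivative.\<close>

lemma inner_collar:
  assumes G: "open G" "frontier G = range c" "G \<noteq> {}"
  obtains N N' t\<^sub>0 \<kappa> B where "0 < t\<^sub>0" "0 < \<kappa>"
    "\<And>x. N (x + 1) = N x" "\<And>x. (N has_vector_derivative N' x) (at x)" "continuous_on UNIV N'"
    "\<And>x. norm (N x) \<le> B" "\<And>x. norm (N' x) \<le> B"
    "\<And>x t. 0 < t \<Longrightarrow> t \<le> t\<^sub>0 \<Longrightarrow> c x + of_real t * N x \<in> G"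
    "\<And>x y t. \<bar>x - y\<bar> \<le> 1/2 \<Longrightarrow> 0 \<le> t \<Longrightarrow> t \<le> t\<^sub>0 \<Longrightarrow>
       \<kappa> * (t + \<bar>x - y\<bar>) \<le> norm (c x + of_real t * N x - c y)"
proof -
  obtain t\<^sub>0 \<kappa> where tk: "0 < t\<^sub>0" "0 < \<kappa>"
    and est: "\<And>x y t v. \<bar>x - y\<bar> \<le> 1/2 \<Longrightarrow> \<bar>t\<bar> \<le> t\<^sub>0 \<Longrightarrow> norm (v - \<i> * c' x) \<le> L / 10 \<Longrightarrow>
       \<kappa> * (\<bar>t\<bar> + \<bar>x - y\<bar>) \<le> norm (c x + of_real t * v - c y)"
    using transversal_estimate by blast
  obtain \<sigma> :: real where \<sigma>: "\<bar>\<sigma>\<bar> = 1"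
    and inG: "\<And>x t v. 0 < t \<Longrightarrow> t \<le> t\<^sub>0 \<Longrightarrow> norm (v - \<i> * c' x) \<le> L / 10 \<Longrightarrow> c x + of_real (\<sigma> * t) * v \<in> G"
    using one_sided_neighbourhood[OF G tk est] by blast
  obtain \<delta> where \<delta>: "\<delta> > 0"
    "\<And>x y. \<bar>x - y\<bar> < \<delta> \<Longrightarrow> norm (c y - c x - of_real (y - x) * c' x) \<le> L / 10 * \<bar>y - x\<bar>"
    using linear_approx[of "L / 10"] L_pos by auto
  \<comment> \<open>Within \<open>\<delta>\<close> secant and tangent differ by at most L/10, so
    \<i> times the difference quotient with step h is an admissible transversal; the sign
    \<open>\<sigma>\<close> then points it into G.\<close>
  define h where "h = \<delta> / 2"
  have h: "0 < h" "h < \<delta>" using \<delta> by (auto simp: h_def)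
  define m where "m = (\<lambda>x. \<i> * (c (x + h) - c x) / of_real h)"
  have m: "norm (m x - \<i> * c' x) \<le> L / 10" for x
  proof -
    have "m x - \<i> * c' x = \<i> / of_real h * (c (x + h) - c x - of_real (x + h - x) * c' x)"
      using h by (simp add: m_def field_simps)
    then have "norm (m x - \<i> * c' x) = norm (c (x + h) - c x - of_real (x + h - x) * c' x) / h"
      using h by (simp add: norm_mult norm_divide)
    also have "\<dots> \<le> (L / 10 * \<bar>x + h - x\<bar>) / h"
      using h by (intro divide_right_mono \<delta>(2)) auto
    finally show ?thesis using h by simp
  qed
  define N where "N = (\<lambda>x. of_real \<sigma> * m x)"
  define N' where "N' = (\<lambda>x. of_real \<sigma> * (\<i> * (c' (x + h) - c' x) / of_real h))"
  define B where "B = max (2 * L) (2 * L / h)"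
  have tN: "of_real t * N x = of_real (\<sigma> * t) * m x" for t x by (simp add: N_def)
  show ?thesis
  proof (rule that[OF tk, of N N' B])
    show "N (x + 1) = N x" for x
      using periodic[of "x + h"] periodic[of x] by (simp add: N_def m_def add_ac)
    show "(N has_vector_derivative N' x) (at x)" for x
    proof -
      have "((\<lambda>x. c (x + h)) has_vector_derivative c' (x + h)) (at x)"
        using vector_diff_chain_at[of "\<lambda>x. x + h" 1 x c "c' (x + h)"] has_derivative[of "x + h"]
        by (simp add: o_def has_vector_derivative_add_const)
      then have "((\<lambda>x. (of_real \<sigma> * \<i> / of_real h) * (c (x + h) - c x)) has_vector_derivative
          (of_real \<sigma> * \<i> / of_real h) * (c' (x + h) - c' x)) (at x)"
        by (intro has_vector_derivative_mult_right has_vector_derivative_diff has_derivative)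
      then show ?thesis by (simp add: N_def m_def N'_def mult.assoc)
    qed
    show "continuous_on UNIV N'"
      unfolding N'_def using h
      by (intro continuous_intros continuous_on_compose2[OF continuous_derivative]) auto
    show "norm (N x) \<le> B" for x
    proof -
      have "norm (m x) \<le> norm (\<i> * c' x) + norm (m x - \<i> * c' x)" by (rule norm_triangle_sub)
      also have "\<dots> \<le> 2 * L" using m[of x] L_pos by (simp add: norm_mult speed)
      finally show ?thesis using \<sigma> by (simp add: N_def B_def norm_mult)
    qed
    show "norm (N' x) \<le> B" for x
    proof -
      have "norm (c' (x + h) - c' x) \<le> 2 * L"
        using norm_triangle_ineq4[of "c' (x + h)" "c' x"] by (simp add: speed)
      then have "norm (N' x) \<le> 2 * L / h"
        using h \<sigma> by (simp add: N'_def norm_mult norm_divide divide_right_mono)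
      then show ?thesis by (simp add: B_def)
    qed
    show "c x + of_real t * N x \<in> G" if "0 < t" "t \<le> t\<^sub>0" for x t
      unfolding tN by (rule inG[OF that m])
    show "\<kappa> * (t + \<bar>x - y\<bar>) \<le> norm (c x + of_real t * N x - c y)"
      if "\<bar>x - y\<bar> \<le> 1/2" "0 \<le> t" "t \<le> t\<^sub>0" for x y t
      using est[OF that(1) _ m, of "\<sigma> * t"] that \<sigma> unfolding tN by (simp add: abs_mult)
  qed
qed

end

section \<open>Boundary values\<close>

text \<open>The geometry enters through the transversal field and \<open>collar_est\<close>, the
  function through its bound F and the growth exponent b of its derivative; the conformal map is
  absorbed in C and b.\<close>

locale collar = smooth_loop +
  fixes G :: "complex set" and N N' :: "real \<Rightarrow> complex" and t\<^sub>0 \<kappa> B :: real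
    and f :: "complex \<Rightarrow> complex" and F C b :: real
  assumes G: "open G" "frontier G = range c"
    and t0_pos: "0 < t\<^sub>0" and kappa_pos: "0 < \<kappa>"
    and N_periodic: "N (x + 1) = N x"
    and N_deriv: "(N has_vector_derivative N' x) (at x)"
    and N'_cont: "continuous_on UNIV N'"
    and N_bound: "norm (N x) \<le> B" and N'_bound: "norm (N' x) \<le> B"
    and collar_in: "0 < t \<Longrightarrow> t \<le> t\<^sub>0 \<Longrightarrow> c x + of_real t * N x \<in> G"
    and collar_est: "\<bar>x - y\<bar> \<le> 1/2 \<Longrightarrow> 0 \<le> t \<Longrightarrow> t \<le> t\<^sub>0 \<Longrightarrow>
       \<kappa> * (t + \<bar>x - y\<bar>) \<le> norm (c x + of_real t * N x - c y)"
    and hol: "f holomorphic_on G"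
    and f_bound: "z \<in> G \<Longrightarrow> norm (f z) \<le> F"
    and b: "0 < b" "b < 1" and C_nonneg: "0 \<le> C"
    and deriv_bound: "z \<in> G \<Longrightarrow> 0 < d \<Longrightarrow> ball z d \<subseteq> G \<Longrightarrow> norm (deriv f z) \<le> C * d powr (- b)"
begin

definition \<gamma> :: "real \<Rightarrow> real \<Rightarrow> complex" where "\<gamma> t x = c x + of_real t * N x"

abbreviation a :: real where "a \<equiv> 1 - b"

lemma B_nonneg: "0 \<le> B"
  using N_bound[of 0] norm_ge_zero order_trans by blast

lemma G_disjoint: "G \<inter> range c = {}"
  using G by (metis frontier_disjoint_eq Int_commute)

lemma gamma_in: "0 < t \<Longrightarrow> t \<le> t\<^sub>0 \<Longrightarrow> \<gamma> t x \<in> G"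
  using collar_in by (simp add: \<gamma>_def)

lemma gamma_periodic: "\<gamma> t (x + 1) = \<gamma> t x"
  using N_periodic periodic by (simp add: \<gamma>_def)

lemma gamma_deriv: "(\<gamma> t has_vector_derivative c' x + of_real t * N' x) (at x)"
  unfolding \<gamma>_def by (intro has_vector_derivative_add has_vector_derivative_mult_right has_derivative N_deriv)

text \<open>\<open>collar_est\<close> keeps the point at distance at least
  \<open>\<kappa> * t\<close> from every c y, so the ball is a connected set that meets G and misses
  its frontier.\<close>

lemma gamma_ball: 
  assumes "0 < t" "t \<le> t\<^sub>0"
  shows "ball (\<gamma> t x) (\<kappa> * t) \<subseteq> G"
proof -
  have "c y \<notin> ball (\<gamma> t x) (\<kappa> * t)" for y
  proof -
    obtain y' where y': "c y' = c y" "\<bar>x - y'\<bar> \<le> 1/2" using near_representative by blast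
    have "\<kappa> * t \<le> \<kappa> * (t + \<bar>x - y'\<bar>)" using kappa_pos by simp
    also have "\<dots> \<le> norm (\<gamma> t x - c y')"
      unfolding \<gamma>_def by (rule collar_est) (use y' assms in auto)
    finally show ?thesis using y' by (simp add: dist_norm)
  qed
  then have "ball (\<gamma> t x) (\<kappa> * t) \<inter> frontier G = {}" using G by auto
  moreover have "\<gamma> t x \<in> ball (\<gamma> t x) (\<kappa> * t)" using kappa_pos assms by simp
  then have "ball (\<gamma> t x) (\<kappa> * t) \<inter> G \<noteq> {}"
    using gamma_in[OF assms, of x] by blast
  ultimately show ?thesis
    using connected_Int_frontier[of "ball (\<gamma> t x) (\<kappa> * t)" G] by auto
qed

definition C\<^sub>1 :: real where "C\<^sub>1 = C * \<kappa> powr (- b)"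

lemma C1_nonneg: "0 \<le> C\<^sub>1"
  using C_nonneg by (simp add: C\<^sub>1_def)

lemma deriv_gamma_bound:
  assumes "0 < t" "t \<le> t\<^sub>0"
  shows "norm (deriv f (\<gamma> t x)) \<le> C\<^sub>1 * t powr (- b)"
  using deriv_bound[OF gamma_in[OF assms] _ gamma_ball[OF assms]] assms kappa_pos
  by (simp add: C\<^sub>1_def powr_mult mult.assoc)

lemma f_deriv: "z \<in> G \<Longrightarrow> (f has_field_derivative deriv f z) (at z)"
  using holomorphic_derivI[OF hol G(1)] .

definition K\<^sub>1 :: real where "K\<^sub>1 = C\<^sub>1 * B / a"

lemma K1_nonneg: "0 \<le> K\<^sub>1"
  using C1_nonneg B_nonneg b by (simp add: K\<^sub>1_def)

text \<open>Mean value inequality against \<open>K\<^sub>1\<close> u^(1-b), whose derivative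
  dominates that of f along the transversal. As b < 1, this comparison function stays bounded at 0,
  hence a bound independent of s.\<close>

lemma normal_oscillation:
  assumes s: "0 < s" "s \<le> t" "t \<le> t\<^sub>0"
  shows "norm (f (\<gamma> t x) - f (\<gamma> s x)) \<le> K\<^sub>1 * t powr a"
proof (cases "s = t")
  case True
  then show ?thesis using K1_nonneg by simp
next
  case False
  have d: "((\<lambda>t. f (\<gamma> t x)) has_vector_derivative N x * deriv f (\<gamma> u x)) (at u)" if "0 < u" "u \<le> t\<^sub>0" for u
  proof -
    have "((\<lambda>t. \<gamma> t x) has_vector_derivative N x) (at u)"
      unfolding \<gamma>_def by (auto intro!: derivative_eq_intros simp: has_vector_derivative_def scaleR_conv_of_real)
    then have "((f \<circ> (\<lambda>t. \<gamma> t x)) has_vector_derivative N x * deriv f (\<gamma> u x)) (at u)"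
      by (rule field_vector_diff_chain_at) (rule f_deriv[OF gamma_in[OF that]])
    then show ?thesis by (simp add: o_def)
  qed
  have p: "((\<lambda>u. K\<^sub>1 * u powr a) has_vector_derivative C\<^sub>1 * B * u powr (- b)) (at u)" if "0 < u" for u
    using that b unfolding has_real_derivative_iff_has_vector_derivative[symmetric]
    by (auto intro!: derivative_eq_intros simp: K\<^sub>1_def)
  have "norm (f (\<gamma> t x) - f (\<gamma> s x)) \<le> K\<^sub>1 * t powr a - K\<^sub>1 * s powr a"
  proof (rule differentiable_bound_general)
    show "s < t" using False s by simp
    show "continuous_on {s..t} (\<lambda>t. f (\<gamma> t x))"
      using s by (intro continuous_at_imp_continuous_on ballI has_vector_derivative_continuous[OF d]) auto
    show "continuous_on {s..t} (\<lambda>u. K\<^sub>1 * u powr a)"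
      using s by (intro continuous_intros) auto
    fix u assume u: "s < u" "u < t"
    show "((\<lambda>t. f (\<gamma> t x)) has_vector_derivative N x * deriv f (\<gamma> u x)) (at u)"
      using u s by (intro d) auto
    show "((\<lambda>u. K\<^sub>1 * u powr a) has_vector_derivative C\<^sub>1 * B * u powr (- b)) (at u)"
      using u s by (intro p) auto
    have "norm (N x) * norm (deriv f (\<gamma> u x)) \<le> B * (C\<^sub>1 * u powr (- b))"
      using u s by (intro mult_mono N_bound deriv_gamma_bound B_nonneg) auto
    then show "norm (N x * deriv f (\<gamma> u x)) \<le> C\<^sub>1 * B * u powr (- b)"
      by (simp add: norm_mult mult_ac)
  qed
  also have "\<dots> \<le> K\<^sub>1 * t powr a" using K1_nonneg by simp
  finally show ?thesis .
qed

definition B\<^sub>2 :: real where "B\<^sub>2 = L + t\<^sub>0 * B"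

lemma B2_nonneg: "0 \<le> B\<^sub>2"
  using L_pos t0_pos B_nonneg by (simp add: B\<^sub>2_def)

lemma gamma_deriv_bound: "0 \<le> t \<Longrightarrow> t \<le> t\<^sub>0 \<Longrightarrow> norm (c' x + of_real t * N' x) \<le> B\<^sub>2"
  unfolding B\<^sub>2_def
  by (intro order_trans[OF norm_triangle_ineq] add_mono)
    (use N'_bound t0_pos in \<open>auto simp: speed norm_mult intro: mult_mono\<close>)

text \<open>At depth t the derivative of f may be as large as t^-b, so the estimate pays off when t
  is at least |x - y|: it is then of order t^(1-b).\<close>

lemma tangential_oscillation:
  assumes t: "0 < t" "t \<le> t\<^sub>0"
  shows "norm (f (\<gamma> t x) - f (\<gamma> t y)) \<le> C\<^sub>1 * t powr (- b) * B\<^sub>2 * \<bar>x - y\<bar>"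
proof -
  have d: "((\<lambda>x. f (\<gamma> t x)) has_vector_derivative (c' u + of_real t * N' u) * deriv f (\<gamma> t u)) (at u)" for u
    using field_vector_diff_chain_at[OF gamma_deriv f_deriv[OF gamma_in[OF t]]] by (simp add: o_def)
  have le: "norm (f (\<gamma> t y) - f (\<gamma> t x)) \<le> C\<^sub>1 * t powr (- b) * B\<^sub>2 * y - C\<^sub>1 * t powr (- b) * B\<^sub>2 * x" if "x < y" for x y
  proof (rule differentiable_bound_general[OF that])
    show "continuous_on {x..y} (\<lambda>x. f (\<gamma> t x))"
      by (intro continuous_at_imp_continuous_on ballI has_vector_derivative_continuous[OF d])
    fix u
    show "((\<lambda>x. f (\<gamma> t x)) has_vector_derivative (c' u + of_real t * N' u) * deriv f (\<gamma> t u)) (at u)" by (rule d)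
    show "((\<lambda>y. C\<^sub>1 * t powr (- b) * B\<^sub>2 * y) has_vector_derivative C\<^sub>1 * t powr (- b) * B\<^sub>2) (at u)"
      unfolding has_real_derivative_iff_has_vector_derivative[symmetric]
      by (auto intro!: derivative_eq_intros)
    have "norm (c' u + of_real t * N' u) * norm (deriv f (\<gamma> t u)) \<le> B\<^sub>2 * (C\<^sub>1 * t powr (- b))"
      using t by (intro mult_mono gamma_deriv_bound deriv_gamma_bound B2_nonneg) auto
    then show "norm ((c' u + of_real t * N' u) * deriv f (\<gamma> t u)) \<le> C\<^sub>1 * t powr (- b) * B\<^sub>2"
      by (simp add: norm_mult mult_ac)
  qed (intro continuous_intros)
  consider "x = y" | "x < y" | "y < x" by linarith
  then show ?thesis
  proof cases
    case 2
    then show ?thesis using le[OF 2] by (simp add: norm_minus_commute algebra_simps)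
  next
    case 3
    then show ?thesis using le[OF 3] by (simp add: algebra_simps)
  qed simp
qed

definition \<tau> :: "nat \<Rightarrow> real" where "\<tau> n = t\<^sub>0 / real (Suc n)"

lemma tau_pos: "0 < \<tau> n" and tau_le: "\<tau> n \<le> t\<^sub>0"
  using t0_pos by (auto simp: \<tau>_def field_simps)

lemma tau_antimono: "n \<le> m \<Longrightarrow> \<tau> m \<le> \<tau> n"
  using t0_pos by (auto simp: \<tau>_def intro!: divide_left_mono)

lemma tau_tendsto: "\<tau> \<longlonglongrightarrow> 0"
proof -
  have "\<tau> = (\<lambda>n. t\<^sub>0 * inverse (real (Suc n)))"
    by (simp add: fun_eq_iff \<tau>_def divide_inverse)
  then show ?thesis
    using tendsto_mult[OF tendsto_const[of t\<^sub>0] LIMSEQ_inverse_real_of_nat] by simp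
qed

lemma tau_powr_tendsto: "(\<lambda>n. \<tau> n powr a) \<longlonglongrightarrow> 0"
  using tendsto_powr'[OF tau_tendsto tendsto_const[of a]] b tau_pos
  by (auto simp: less_imp_le)

definition fb :: "real \<Rightarrow> complex" where "fb x = lim (\<lambda>n. f (\<gamma> (\<tau> n) x))"

lemma fb_LIMSEQ: "(\<lambda>n. f (\<gamma> (\<tau> n) x)) \<longlonglongrightarrow> fb x"
proof -
  have "Cauchy (\<lambda>n. f (\<gamma> (\<tau> n) x))"
  proof (rule CauchyI')
    fix e :: real assume e: "0 < e"
    have "(\<lambda>n. K\<^sub>1 * \<tau> n powr a) \<longlonglongrightarrow> K\<^sub>1 * 0" by (intro tendsto_intros tau_powr_tendsto)
    then have "\<forall>\<^sub>F n in sequentially. K\<^sub>1 * \<tau> n powr a < e" using e by (intro order_tendstoD) auto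
    then obtain M where M: "\<And>n. n \<ge> M \<Longrightarrow> K\<^sub>1 * \<tau> n powr a < e" by (auto simp: eventually_sequentially)
    have "norm (f (\<gamma> (\<tau> m) x) - f (\<gamma> (\<tau> n) x)) < e" if "m \<ge> M" "n > m" for m n
      using normal_oscillation[OF tau_pos tau_antimono tau_le, of m n x] M[of m] that by simp
    then show "\<exists>M. \<forall>m\<ge>M. \<forall>n>m. dist (f (\<gamma> (\<tau> m) x)) (f (\<gamma> (\<tau> n) x)) < e"
      unfolding dist_norm by blast
  qed
  then show ?thesis
    unfolding fb_def convergent_LIMSEQ_iff[symmetric] by (rule Cauchy_convergent)
qed

lemma fb_periodic: "fb (x + 1) = fb x"
  by (simp add: fb_def gamma_periodic)

lemma fb_cong:
  assumes "c x = c y" shows "fb x = fb y"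
  using periodic_add_of_int[of fb y, OF fb_periodic] by (subst eq_imp_int[OF assms]) (simp del: of_int_diff)

lemma fb_bound: "norm (fb x) \<le> F"
  by (rule LIMSEQ_le_const2[OF tendsto_norm[OF fb_LIMSEQ]])
    (use f_bound gamma_in tau_pos tau_le in blast)

lemma fb_approx:
  assumes t: "0 < t" "t \<le> t\<^sub>0"
  shows "norm (f (\<gamma> t x) - fb x) \<le> K\<^sub>1 * t powr a"
proof (rule LIMSEQ_le_const2)
  show "(\<lambda>n. norm (f (\<gamma> t x) - f (\<gamma> (\<tau> n) x))) \<longlonglongrightarrow> norm (f (\<gamma> t x) - fb x)"
    by (intro tendsto_intros fb_LIMSEQ)
  have "\<forall>\<^sub>F n in sequentially. \<tau> n < t" using tau_tendsto t by (intro order_tendstoD) auto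
  then obtain M where M: "\<And>n. n \<ge> M \<Longrightarrow> \<tau> n < t" by (auto simp: eventually_sequentially)
  then show "\<exists>M. \<forall>n\<ge>M. norm (f (\<gamma> t x) - f (\<gamma> (\<tau> n) x)) \<le> K\<^sub>1 * t powr a"
    using normal_oscillation[OF tau_pos _ t(2)] by (intro exI[of _ M]) (auto simp: less_imp_le)
qed

definition K\<^sub>2 :: real where "K\<^sub>2 = 2 * K\<^sub>1 + C\<^sub>1 * B\<^sub>2 + 2 * F / t\<^sub>0 powr a"

lemma F_nonneg: "0 \<le> F"
  using fb_bound[of 0] norm_ge_zero order_trans by blast

lemma K2_nonneg: "0 \<le> K\<^sub>2"
  using K1_nonneg C1_nonneg B2_nonneg F_nonneg by (simp add: K\<^sub>2_def)

lemma holder_interior: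
  assumes t: "0 < t" "t \<le> t\<^sub>0"
  shows "norm (f (\<gamma> t x) - fb y) \<le> K\<^sub>2 * (t + \<bar>x - y\<bar>) powr a"
proof -
  define r where "r = max t \<bar>x - y\<bar>"
  have r: "0 < r" "t \<le> r" "\<bar>x - y\<bar> \<le> r" "r \<le> t + \<bar>x - y\<bar>" using t by (auto simp: r_def)
  have "norm (f (\<gamma> t x) - fb y) \<le> K\<^sub>2 * r powr a"
  proof (cases "r \<le> t\<^sub>0")
    case True
    have 1: "norm (f (\<gamma> r x) - f (\<gamma> t x)) \<le> K\<^sub>1 * r powr a"
      by (rule normal_oscillation) (use t r True in auto)
    have "norm (f (\<gamma> r x) - f (\<gamma> r y)) \<le> C\<^sub>1 * r powr (- b) * B\<^sub>2 * \<bar>x - y\<bar>"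
      by (rule tangential_oscillation) (use r True in auto)
    also have "\<dots> \<le> C\<^sub>1 * r powr (- b) * B\<^sub>2 * r"
      using r C1_nonneg B2_nonneg by (intro mult_left_mono) auto
    also have "\<dots> = C\<^sub>1 * B\<^sub>2 * (r powr (- b) * r powr 1)" using r by simp
    also have "r powr (- b) * r powr 1 = r powr a" unfolding powr_add[symmetric] by simp
    finally have 2: "norm (f (\<gamma> r x) - f (\<gamma> r y)) \<le> C\<^sub>1 * B\<^sub>2 * r powr a" .
    have 3: "norm (f (\<gamma> r y) - fb y) \<le> K\<^sub>1 * r powr a"
      by (rule fb_approx) (use r True in auto)
    have eq: "f (\<gamma> t x) - fb y = (f (\<gamma> r x) - f (\<gamma> r y)) + (f (\<gamma> r y) - fb y) - (f (\<gamma> r x) - f (\<gamma> t x))" by simp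
    have "norm (f (\<gamma> t x) - fb y) \<le> C\<^sub>1 * B\<^sub>2 * r powr a + K\<^sub>1 * r powr a + K\<^sub>1 * r powr a"
      unfolding eq using 1 2 3 norm_triangle_ineq[of "f (\<gamma> r x) - f (\<gamma> r y)" "f (\<gamma> r y) - fb y"]
        norm_triangle_ineq4[of "(f (\<gamma> r x) - f (\<gamma> r y)) + (f (\<gamma> r y) - fb y)" "f (\<gamma> r x) - f (\<gamma> t x)"]
      by linarith
    also have "\<dots> = (2 * K\<^sub>1 + C\<^sub>1 * B\<^sub>2) * r powr a" by (simp add: algebra_simps)
    also have "\<dots> \<le> K\<^sub>2 * r powr a"
      unfolding K\<^sub>2_def using F_nonneg by (intro mult_right_mono) auto
    finally show ?thesis .
  next
    case False
    have "norm (f (\<gamma> t x) - fb y) \<le> norm (f (\<gamma> t x)) + norm (fb y)" by (rule norm_triangle_ineq4)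
    also have "\<dots> \<le> 2 * F" using f_bound[OF gamma_in[OF t, of x]] fb_bound[of y] by simp
    also have "\<dots> = 2 * F / t\<^sub>0 powr a * t\<^sub>0 powr a" using t0_pos by simp
    also have "\<dots> \<le> 2 * F / t\<^sub>0 powr a * r powr a"
      using False t0_pos b F_nonneg by (intro mult_left_mono powr_mono2) auto
    also have "\<dots> \<le> K\<^sub>2 * r powr a"
      unfolding K\<^sub>2_def using K1_nonneg C1_nonneg B2_nonneg by (intro mult_right_mono) auto
    finally show ?thesis .
  qed
  also have "\<dots> \<le> K\<^sub>2 * (t + \<bar>x - y\<bar>) powr a"
    using r b K2_nonneg by (intro mult_left_mono powr_mono2) auto
  finally show ?thesis .
qed

lemma chord_lower:
  assumes "0 \<le> t" "t \<le> t\<^sub>0"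
  shows "\<exists>y'. c y' = c y \<and> \<kappa> * \<bar>x - y'\<bar> \<le> norm (c x - c y) \<and> \<kappa> * (t + \<bar>x - y'\<bar>) \<le> norm (\<gamma> t x - c y)"
proof -
  obtain y' where y': "c y' = c y" "\<bar>x - y'\<bar> \<le> 1/2" using near_representative by blast
  show ?thesis
    using collar_est[OF y'(2), of 0] collar_est[OF y'(2) assms] y' t0_pos
    by (intro exI[of _ y']) (simp add: \<gamma>_def)
qed

lemma chord_upper: "norm (c x - c y) \<le> L * \<bar>x - y\<bar>"
proof -
  have le: "norm (c y - c x) \<le> L * y - L * x" if "x < y" for x y
  proof (rule differentiable_bound_general[OF that, where f' = c' and \<phi>' = "\<lambda>_. L"])
    show "((\<lambda>y. L * y) has_vector_derivative L) (at u)" for u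
      unfolding has_real_derivative_iff_has_vector_derivative[symmetric]
      by (auto intro!: derivative_eq_intros)
    show "norm (c' u) \<le> L" for u by (simp add: speed)
  qed (intro continuous_intros continuous has_derivative)+
  consider "x = y" | "x < y" | "y < x" by linarith
  then show ?thesis
  proof cases
    case 2
    then show ?thesis using le[OF 2] by (simp add: norm_minus_commute algebra_simps)
  next
    case 3
    then show ?thesis using le[OF 3] by (simp add: algebra_simps)
  qed simp
qed

text \<open>Boundary values as a function of the point, since the measures live on the curve and not
  on parameters. By \<open>fb_cong\<close> the choice of the parameter is immaterial.\<close>

definition fhat :: "complex \<Rightarrow> complex" where "fhat \<zeta> = fb (SOME y. c y = \<zeta>)"

lemma fhat_c: "fhat (c y) = fb y"
  unfolding fhat_def by (rule fb_cong) (rule someI_ex, blast)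

definition K\<^sub>3 :: real where "K\<^sub>3 = K\<^sub>2 * (1 + 1 / \<kappa>) powr a"

lemma K3_nonneg: "0 \<le> K\<^sub>3"
  using K2_nonneg by (simp add: K\<^sub>3_def)

text \<open>Parameter distance is traded for chord length through |x - y'| \<le> |c x - c y| /
  \<kappa>. Together with \<open>chord_gamma\<close> it measures numerator and denominator of the
  quotient by the same quantity t + |c x - c y|.\<close>

lemma holder_interior_chord:
  assumes t: "0 < t" "t \<le> t\<^sub>0"
  shows "norm (f (\<gamma> t x) - fhat (c y)) \<le> K\<^sub>3 * (t + norm (c x - c y)) powr a"
proof -
  obtain y' where y': "c y' = c y" "\<kappa> * \<bar>x - y'\<bar> \<le> norm (c x - c y)" using chord_lower t by fastforce
  have "norm (f (\<gamma> t x) - fhat (c y)) \<le> K\<^sub>2 * (t + \<bar>x - y'\<bar>) powr a"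
    using holder_interior[OF t, of x y'] fhat_c y'(1) by metis
  also have "\<dots> \<le> K\<^sub>2 * ((1 + 1 / \<kappa>) * (t + norm (c x - c y))) powr a"
  proof -
    have "\<bar>x - y'\<bar> \<le> norm (c x - c y) / \<kappa>" using y' kappa_pos by (simp add: pos_le_divide_eq mult.commute)
    moreover have "0 \<le> t / \<kappa>" using t kappa_pos by simp
    ultimately have "t + \<bar>x - y'\<bar> \<le> (1 + 1 / \<kappa>) * (t + norm (c x - c y))"
      by (simp add: distrib_left distrib_right) (smt (verit) norm_ge_zero)
    then show ?thesis
      using b t K2_nonneg by (intro mult_left_mono powr_mono2) auto
  qed
  also have "\<dots> = K\<^sub>3 * (t + norm (c x - c y)) powr a"
    using kappa_pos t by (subst powr_mult) (auto simp: K\<^sub>3_def intro: add_nonneg_nonneg)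
  finally show ?thesis .
qed

lemma holder_boundary: "norm (fhat (c x) - fhat (c y)) \<le> K\<^sub>3 * norm (c x - c y) powr a"
proof (cases "c x = c y")
  case True
  then show ?thesis by simp
next
  case False
  have up: "(\<lambda>n. K\<^sub>3 * (\<tau> n + norm (c x - c y)) powr a) \<longlonglongrightarrow> K\<^sub>3 * (0 + norm (c x - c y)) powr a"
    using False by (intro tendsto_intros tau_tendsto) auto
  have lo: "(\<lambda>n. norm (f (\<gamma> (\<tau> n) x) - fhat (c y))) \<longlonglongrightarrow> norm (fhat (c x) - fhat (c y))"
    unfolding fhat_c by (intro tendsto_intros fb_LIMSEQ)
  have "norm (fhat (c x) - fhat (c y)) \<le> K\<^sub>3 * (0 + norm (c x - c y)) powr a"
    by (rule LIMSEQ_le[OF lo up]) (use holder_interior_chord[OF tau_pos tau_le] in blast)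
  then show ?thesis by simp
qed

lemma chord_gamma:
  assumes t: "0 \<le> t" "t \<le> t\<^sub>0"
  shows "\<kappa> / (1 + L) * (t + norm (c x - c y)) \<le> norm (\<gamma> t x - c y)"
proof -
  obtain y' where y': "c y' = c y" "\<kappa> * (t + \<bar>x - y'\<bar>) \<le> norm (\<gamma> t x - c y)"
    using chord_lower[OF t] by blast
  have "norm (c x - c y) \<le> L * \<bar>x - y'\<bar>" using chord_upper[of x y'] y' by simp
  then have "t + norm (c x - c y) \<le> (1 + L) * (t + \<bar>x - y'\<bar>)"
    using L_pos t by (simp add: distrib_left distrib_right) (smt (verit) mult_nonneg_nonneg)
  then have "\<kappa> / (1 + L) * (t + norm (c x - c y)) \<le> \<kappa> / (1 + L) * ((1 + L) * (t + \<bar>x - y'\<bar>))"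
    using kappa_pos L_pos by (intro mult_left_mono) auto
  also have "\<dots> = \<kappa> * (t + \<bar>x - y'\<bar>)" using L_pos by simp
  finally show ?thesis using y' by linarith
qed

lemma continuous_fhat: "continuous_on (range c) fhat"
  unfolding continuous_on_def
proof (intro ballI)
  fix \<zeta> assume "\<zeta> \<in> range c"
  have "((\<lambda>\<xi>. K\<^sub>3 * norm (\<xi> - \<zeta>) powr a) \<longlongrightarrow> K\<^sub>3 * norm (\<zeta> - \<zeta>) powr a) (at \<zeta> within range c)"
    using b by (intro tendsto_mult tendsto_const tendsto_powr' tendsto_intros) auto
  then have "((\<lambda>\<xi>. K\<^sub>3 * norm (\<xi> - \<zeta>) powr a) \<longlongrightarrow> 0) (at \<zeta> within range c)" by simp
  moreover have "\<forall>\<^sub>F \<xi> in at \<zeta> within range c. norm (fhat \<xi> - fhat \<zeta>) \<le> K\<^sub>3 * norm (\<xi> - \<zeta>) powr a"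
    unfolding eventually_at_filter
    using holder_boundary \<open>\<zeta> \<in> range c\<close> by (intro always_eventually) auto
  ultimately have "((\<lambda>\<xi>. fhat \<xi> - fhat \<zeta>) \<longlongrightarrow> 0) (at \<zeta> within range c)"
    by (rule Lim_null_comparison[rotated])
  then show "(fhat \<longlongrightarrow> fhat \<zeta>) (at \<zeta> within range c)" by (simp add: LIM_zero_iff)
qed

end

section \<open>Cauchy integrals of the boundary values\<close>

text \<open>Here |x - s| \<le> 2, so each side of the singularity costs at most the integral of u^-b
  over {0..2}. The range of s allows for representatives shifted by one period.\<close>

lemma nn_integral_abs_powr:
  fixes b s :: real
  assumes b: "0 < b" "b < 1" and s: "-1 \<le> s" "s \<le> 2"
  shows "(\<integral>\<^sup>+x. ennreal (indicator {0..1} x * \<bar>x - s\<bar> powr (- b)) \<partial>lborel) \<le> ennreal (2 * (2 powr (1 - b) / (1 - b)))"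
proof -
  define h :: "real \<Rightarrow> ennreal" where "h u = ennreal (u powr (- b)) * indicator {0..2} u" for u
  have [measurable]: "h \<in> borel_measurable borel" unfolding h_def by measurable
  have "((\<lambda>x. x powr (- b)) has_integral (2 powr (- b + 1) / (- b + 1))) {0..2::real}"
    by (rule has_integral_powr_from_0) (use b in auto)
  then have h: "(\<integral>\<^sup>+u. h u \<partial>lborel) = ennreal (2 powr (1 - b) / (1 - b))"
    unfolding h_def using nn_integral_has_integral_lebesgue'[of "{0..2}" "\<lambda>x. x powr (- b)"]
    by (simp add: add.commute)
  have h': "(\<integral>\<^sup>+u. h (- u) \<partial>lborel) = (\<integral>\<^sup>+u. h u \<partial>lborel)"
    using nn_integral_real_affine[of h "-1" 0] by simp
  have "(\<integral>\<^sup>+x. ennreal (indicator {0..1} x * \<bar>x - s\<bar> powr (- b)) \<partial>lborel) \<le> (\<integral>\<^sup>+x. h (- s + 1 * x) + h (- (- s + 1 * x)) \<partial>lborel)"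
    using s by (intro nn_integral_mono) (auto simp: h_def indicator_def abs_if)
  also have "\<dots> = (\<integral>\<^sup>+x. h x + h (- x) \<partial>lborel)"
    using nn_integral_real_affine[of "\<lambda>x. h x + h (- x)" 1 "-s"] by simp
  also have "\<dots> = (\<integral>\<^sup>+x. h x \<partial>lborel) + (\<integral>\<^sup>+x. h (- x) \<partial>lborel)"
    by (rule nn_integral_add) auto
  also have "\<dots> = ennreal (2 * (2 powr (1 - b) / (1 - b)))"
    unfolding h' h using b by (subst ennreal_plus[symmetric]) auto
  finally show ?thesis .
qed

context collar
begin

definition J :: real where "J = \<kappa> powr (- b) * (3 * (2 * (2 powr (1 - b) / (1 - b))))"

lemma c_measurable [measurable]: "c \<in> borel_measurable borel"
  by (rule borel_measurable_continuous_onI) (rule continuous)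

lemma c'_measurable [measurable]: "c' \<in> borel_measurable borel"
  by (rule borel_measurable_continuous_onI) (rule continuous_derivative)

text \<open>For x in {0..1} the nearest parameter of c y is z - 1, z or z + 1, whence the factor 3
  in \<open>J\<close>. Uniformity in y matters: the bound is later integrated over the point c y
  against an arbitrary finite measure.\<close>

lemma chord_powr_integral:
  "(\<integral>\<^sup>+x. ennreal (indicator {0..1} x * norm (c x - c y) powr (- b)) \<partial>lborel) \<le> ennreal J"
proof -
  define z where "z = frac y"
  have z: "0 \<le> z" "z \<le> 1" "c z = c y" using frac_ge_0[of y] frac_lt_1[of y] eq_frac by (auto simp: z_def)
  let ?q = "\<lambda>s x. ennreal (indicator {0..1} x * \<bar>x - s\<bar> powr (- b))"
  have "ennreal (indicator {0..1} x * norm (c x - c y) powr (- b)) \<le>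
      ennreal (\<kappa> powr (- b)) * (?q z x + ?q (z - 1) x + ?q (z + 1) x)" for x
  \<comment> \<open>If c x = c y, the left-hand side is 0, because 0 powr (- b) = 0.\<close>
  proof (cases "x \<in> {0..1} \<and> c x \<noteq> c y")
    case True
    obtain y' where y': "c y' = c z" "\<bar>x - y'\<bar> \<le> 1/2" using near_representative by blast
    define k where "k = floor y' - floor z"
    have k: "y' = z + of_int k" using eq_imp_int[OF y'(1)] by (simp add: k_def)
    then have "\<bar>of_int k :: real\<bar> < 2" using True z y' by (auto simp: abs_if split: if_splits)
    then have "\<bar>k\<bar> < 2" by linarith
    then have "k \<in> {-1, 0, 1}" by auto
    then have cases: "y' \<in> {z, z - 1, z + 1}" using k by auto
    have "x \<noteq> y'" using True y' z by auto
    have "\<kappa> * \<bar>x - y'\<bar> \<le> norm (c x - c y)"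
      using collar_est[OF y'(2), of 0] t0_pos y' z by simp
    then have "norm (c x - c y) powr (- b) \<le> (\<kappa> * \<bar>x - y'\<bar>) powr (- b)"
      using kappa_pos b \<open>x \<noteq> y'\<close> by (intro powr_mono2') auto
    also have "\<dots> = \<kappa> powr (- b) * \<bar>x - y'\<bar> powr (- b)"
      using kappa_pos by (simp add: powr_mult)
    finally have "ennreal (indicator {0..1} x * norm (c x - c y) powr (- b)) \<le> ennreal (\<kappa> powr (- b)) * ?q y' x"
      using True by (simp add: ennreal_mult[symmetric] ennreal_leI)
    also have "?q y' x \<le> ?q z x + ?q (z - 1) x + ?q (z + 1) x"
      using cases by (auto intro: add_increasing add_increasing2)
    finally show ?thesis by (simp add: mult_left_mono)
  qed auto
  then have "(\<integral>\<^sup>+x. ennreal (indicator {0..1} x * norm (c x - c y) powr (- b)) \<partial>lborel) \<le>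
      (\<integral>\<^sup>+x. ennreal (\<kappa> powr (- b)) * (?q z x + ?q (z - 1) x + ?q (z + 1) x) \<partial>lborel)"
    by (intro nn_integral_mono)
  also have "\<dots> = ennreal (\<kappa> powr (- b)) * ((\<integral>\<^sup>+x. ?q z x \<partial>lborel) + (\<integral>\<^sup>+x. ?q (z - 1) x \<partial>lborel) + (\<integral>\<^sup>+x. ?q (z + 1) x \<partial>lborel))"
    by (simp add: nn_integral_cmult nn_integral_add)
  also have "\<dots> \<le> ennreal (\<kappa> powr (- b)) * (ennreal (2 * (2 powr (1 - b) / (1 - b))) + ennreal (2 * (2 powr (1 - b) / (1 - b))) + ennreal (2 * (2 powr (1 - b) / (1 - b))))"
    using z b by (intro mult_left_mono add_mono nn_integral_abs_powr) auto
  also have "\<dots> = ennreal J"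
    unfolding J_def using b by (simp add: ennreal_mult[symmetric] ennreal_plus[symmetric] del: ennreal_plus)
  finally show ?thesis .
qed

lemma chord_powr_integrable: "integrable lborel (\<lambda>x. indicator {0..1} x * norm (c x - c y) powr (- b))"
  unfolding integrable_iff_bounded
  using le_less_trans[OF chord_powr_integral, of \<infinity>] by (auto simp: abs_mult)

section \<open>Winding numbers and the Cauchy formula on the inner curves\<close>

lemma simple_path: "simple_path c"
proof -
  have "x = y \<or> x = 0 \<and> y = 1 \<or> x = 1 \<and> y = 0" if "0 \<le> x" "x \<le> 1" "0 \<le> y" "y \<le> 1" "c x = c y" for x y
  proof -
    define k where "k = floor x - floor y"
    have k: "x = y + of_int k" using eq_imp_int[OF that(5)] by (simp add: k_def)
    then have "\<bar>of_int k :: real\<bar> < 2" using that by auto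
    then have "\<bar>k\<bar> < 2" by linarith
    then have "k \<in> {-1, 0, 1}" by auto
    then show ?thesis using k that by auto
  qed
  then show ?thesis
    unfolding simple_path_def loop_free_def by (auto simp: path_def continuous)
qed

lemma path_image_c: "path_image c = range c"
proof -
  have "c ` {0..<1} \<subseteq> c ` {0..1}" by (intro image_mono) auto
  then show ?thesis using range_eq by (auto simp: path_image_def)
qed

text \<open>A component of the complement of the curve that meets G cannot cross the frontier, so it
  stays in the bounded set G. Hence G lies inside the curve, where the winding number is constantly
  1 or -1, depending on the orientation.\<close>

lemma winding_number_const:
  assumes "bounded G"
  obtains w where "w \<noteq> 0" "\<And>z. z \<in> G \<Longrightarrow> winding_number c z = w"
proof -
  have "G \<subseteq> inside (path_image c)"
  proof
    fix z assume z: "z \<in> G"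
    have "connected_component_set (- range c) z \<subseteq> G"
    proof (rule ccontr)
      assume "\<not> ?thesis"
      moreover have "z \<in> connected_component_set (- range c) z"
        using z G_disjoint by (auto simp: connected_component_refl_eq)
      ultimately have "connected_component_set (- range c) z \<inter> frontier G \<noteq> {}"
        using z by (intro connected_Int_frontier connected_connected_component) blast+
      then show False using G connected_component_subset[of "- range c" z] by auto
    qed
    then show "z \<in> inside (path_image c)"
      using assms z G_disjoint bounded_subset unfolding inside_def path_image_c by auto
  qed
  then show ?thesis
    using simple_closed_path_winding_number_inside[OF simple_path] that
    by (metis one_neq_neg_one subsetD zero_neq_neg_one zero_neq_one)
qed

lemma gamma_far:
  assumes z: "z \<in> G"
  obtains d t\<^sub>1 where "0 < d" "0 < t\<^sub>1" "\<And>x t. 0 \<le> t \<Longrightarrow> t \<le> t\<^sub>1 \<Longrightarrow> d \<le> norm (\<gamma> t x - z)"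
proof -
  obtain e where e: "0 < e" "ball z e \<subseteq> G" using z G openE by blast
  have far: "e \<le> norm (c x - z)" for x
  proof -
    have "c x \<notin> ball z e" using e(2) G_disjoint by blast
    then show ?thesis by (simp add: dist_norm norm_minus_commute)
  qed
  have "e / 2 \<le> norm (\<gamma> t x - z)" if t: "0 \<le> t" "t \<le> e / (2 * (B + 1))" for t x
  proof -
    have "t * norm (N x) \<le> e / (2 * (B + 1)) * (B + 1)"
      using t N_bound[of x] B_nonneg e by (intro mult_mono) auto
    also have "\<dots> = e / 2"
    proof -
      have "2 * B + 2 \<noteq> 0" using B_nonneg by linarith
      then show ?thesis by (simp add: field_simps)
    qed
    finally have "norm (of_real t * N x) \<le> e / 2" using t by (simp add: norm_mult)
    moreover have "norm (c x - z) \<le> norm (\<gamma> t x - z) + norm (of_real t * N x)"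
      using norm_triangle_ineq4[of "\<gamma> t x - z" "of_real t * N x"] by (simp add: \<gamma>_def)
    ultimately show ?thesis using far[of x] by linarith
  qed
  then show ?thesis
    using e B_nonneg by (intro that[of "e / 2" "e / (2 * (B + 1))"]) auto
qed

lemma gamma_continuous: "continuous_on S (\<gamma> t)"
  by (intro continuous_at_imp_continuous_on ballI has_vector_derivative_continuous[OF gamma_deriv])

lemma gamma_deriv_continuous: "continuous_on S (\<lambda>x. c' x + of_real t * N' x)"
  using continuous_derivative N'_cont
  by (intro continuous_intros) (auto intro: continuous_on_subset)

lemma gamma_valid_path: "valid_path (\<gamma> t)"
  unfolding valid_path_def
  by (rule C1_differentiable_imp_piecewise)
    (unfold C1_differentiable_on_def, intro exI[of _ "\<lambda>x. c' x + of_real t * N' x"] conjI ballI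
      gamma_deriv gamma_deriv_continuous)

lemma gamma_closed: "pathfinish (\<gamma> t) = pathstart (\<gamma> t)"
  using gamma_periodic[of t 0] by (simp add: pathstart_def pathfinish_def)

lemma gamma_0: "\<gamma> 0 = c"
  by (simp add: \<gamma>_def fun_eq_iff)

text \<open>The segment from c x to \<gamma> t x consists of points \<gamma> s x with 0 \<le> s
  \<le> t, so the straight-line homotopy avoids z.\<close>

lemma winding_number_gamma:
  assumes far: "\<And>s x. 0 \<le> s \<Longrightarrow> s \<le> t \<Longrightarrow> \<gamma> s x \<noteq> z" and t: "0 \<le> t"
  shows "winding_number (\<gamma> t) z = winding_number c z"
proof (rule winding_number_loops_linear_eq)
  show "path c" by (simp add: path_def continuous)
  show "path (\<gamma> t)" by (simp add: path_def gamma_continuous)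
  show "pathfinish c = pathstart c" using gamma_closed[of 0] by (simp add: gamma_0)
  show "pathfinish (\<gamma> t) = pathstart (\<gamma> t)" by (rule gamma_closed)
  fix x
  show "z \<notin> closed_segment (c x) (\<gamma> t x)"
  proof
    assume "z \<in> closed_segment (c x) (\<gamma> t x)"
    then obtain u where u: "0 \<le> u" "u \<le> 1" "z = (1 - u) *\<^sub>R c x + u *\<^sub>R \<gamma> t x"
      by (auto simp: in_segment)
    then have "z = \<gamma> (u * t) x"
      by (simp add: \<gamma>_def scaleR_conv_of_real algebra_simps)
    moreover have "u * t \<le> 1 * t" using u t by (intro mult_right_mono) auto
    ultimately show False using far[of "u * t" x] u t by simp
  qed
qed

text \<open>As \<zeta> lies on the frontier, the quotient is holomorphic in all of G, and simple
  connectivity annihilates the winding numbers about points outside G. The integral is written over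
  \<open>lborel\<close> with an indicator, ready for dominated convergence.\<close>

lemma cauchy_formula_gamma:
  assumes sc: "simply_connected G" and z: "z \<in> G" and y: "\<zeta> \<in> range c"
    and t: "0 < t" "t \<le> t\<^sub>0" and far: "\<And>s x. 0 \<le> s \<Longrightarrow> s \<le> t \<Longrightarrow> \<gamma> s x \<noteq> z"
  shows "(LINT x|lborel. indicator {0..1} x *\<^sub>R
      ((f (\<gamma> t x) - fhat \<zeta>) / (\<zeta> - \<gamma> t x) / (\<gamma> t x - z) * (c' x + of_real t * N' x))) =
      2 * pi * \<i> * winding_number c z * ((f z - fhat \<zeta>) / (\<zeta> - z))"
    and "integrable lborel (\<lambda>x. indicator {0..1} x *\<^sub>R
      ((f (\<gamma> t x) - fhat \<zeta>) / (\<zeta> - \<gamma> t x) / (\<gamma> t x - z) * (c' x + of_real t * N' x)))"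
proof -
  let ?k = "\<lambda>w. (f w - fhat \<zeta>) / (\<zeta> - w)"
  let ?I = "\<lambda>x. ?k (\<gamma> t x) / (\<gamma> t x - z) * (c' x + of_real t * N' x)"
  have nz: "\<zeta> - w \<noteq> 0" if "w \<in> G" for w using that y G_disjoint by auto
  have kh: "?k holomorphic_on G"
    by (intro holomorphic_intros hol) (use nz in auto)
  have pim: "path_image (\<gamma> t) \<subseteq> G" using gamma_in[OF t] by (auto simp: path_image_def)
  have wn: "winding_number (\<gamma> t) z = winding_number c z"
    by (rule winding_number_gamma) (use far t in auto)
  have "((\<lambda>w. ?k w / (w - z)) has_contour_integral (2 * pi * \<i> * winding_number (\<gamma> t) z * ?k z)) (\<gamma> t)"
  proof (rule Cauchy_integral_formula_global[OF G(1) kh z gamma_valid_path _ gamma_closed])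
    show "path_image (\<gamma> t) \<subseteq> G - {z}"
      using pim far[of t] t by (auto simp: path_image_def)
    show "winding_number (\<gamma> t) w = 0" if "w \<notin> G" for w
      by (rule simply_connected_imp_winding_number_zero[OF sc valid_path_imp_path[OF gamma_valid_path] pim gamma_closed that])
  qed
  then have "((\<lambda>x. ?k (\<gamma> t x) / (\<gamma> t x - z) * vector_derivative (\<gamma> t) (at x within {0..1})) has_integral
      (2 * pi * \<i> * winding_number c z * ?k z)) {0..1}"
    by (simp add: has_contour_integral_def wn)
  then have hi: "(?I has_integral (2 * pi * \<i> * winding_number c z * ?k z)) {0..1}"
    by (rule has_integral_eq[rotated]) (simp add: vector_derivative_at_within_ivl[OF gamma_deriv])
  have "continuous_on {0..1} (\<lambda>x. f (\<gamma> t x))"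
    by (rule continuous_on_compose2[OF holomorphic_on_imp_continuous_on[OF hol] gamma_continuous])
      (use gamma_in[OF t] in auto)
  then have "continuous_on {0..1} ?I"
    using nz[OF gamma_in[OF t]] far[of t] t
    by (intro continuous_intros gamma_continuous gamma_deriv_continuous) auto
  then have si: "set_integrable lborel {0..1} ?I" by (rule borel_integrable_atLeastAtMost')
  then show "integrable lborel (\<lambda>x. indicator {0..1} x *\<^sub>R ?I x)" by (simp add: set_integrable_def)
  have "(LINT x:{0..1}|lborel. ?I x) = integral {0..1} ?I" by (rule set_borel_integral_eq_integral[OF si])
  also have "\<dots> = 2 * pi * \<i> * winding_number c z * ?k z" using hi by (rule integral_unique)
  finally show "(LINT x|lborel. indicator {0..1} x *\<^sub>R ?I x) = 2 * pi * \<i> * winding_number c z * ?k z"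
    by (simp add: set_lebesgue_integral_def)
qed

section \<open>Passage to the curve and interchange of the integrations\<close>

definition H :: "complex \<Rightarrow> real \<Rightarrow> complex" where
  "H \<zeta> x = (fhat (c x) - fhat \<zeta>) / (\<zeta> - c x) * c' x"

text \<open>Hoelder continuity gains the power 1 - b against the simple pole. At c x = \<zeta> both
  sides are 0 by the conventions for division by 0 and powers of 0.\<close>

lemma H_bound:
  assumes "\<zeta> \<in> range c"
  shows "norm (H \<zeta> x) \<le> K\<^sub>3 * L * norm (c x - \<zeta>) powr (- b)"
proof (cases "c x = \<zeta>")
  case True
  then show ?thesis by (simp add: H_def)
next
  case False
  have n: "norm (\<zeta> - c x) = norm (c x - \<zeta>)" by (rule norm_minus_commute)
  have "norm (H \<zeta> x) \<le> K\<^sub>3 * norm (c x - \<zeta>) powr a / norm (c x - \<zeta>) * L"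
    unfolding H_def norm_mult norm_divide speed n
    using holder_boundary assms L_pos by (intro mult_right_mono divide_right_mono) auto
  also have "norm (c x - \<zeta>) powr a = norm (c x - \<zeta>) powr (- b) * norm (c x - \<zeta>)"
    using False powr_add[of "norm (c x - \<zeta>)" "- b" 1] by simp
  finally show ?thesis using False by (simp add: mult_ac)
qed

lemma fhat_c_continuous: "continuous_on S (\<lambda>x. fhat (c x))"
  by (rule continuous_on_compose2[OF continuous_fhat continuous]) auto

lemma fhat_c_measurable [measurable]: "(\<lambda>x. fhat (c x)) \<in> borel_measurable borel"
  by (rule borel_measurable_continuous_onI) (rule fhat_c_continuous)

lemma AE_chord: "AE x in lborel. c x \<noteq> \<zeta>"
proof (cases "\<zeta> \<in> range c")
  case True
  then obtain y where y: "\<zeta> = c y" by auto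
  have "{x. c x = \<zeta>} \<subseteq> (\<lambda>k::int. y + of_int k) ` UNIV"
    using eq_imp_int unfolding y by blast
  then have "countable {x. c x = \<zeta>}" by (rule countable_subset) auto
  then have "{x. c x = \<zeta>} \<in> null_sets lborel" by (rule countable_imp_null_set_lborel)
  then show ?thesis by (rule AE_I'[where P = "\<lambda>x. c x \<noteq> \<zeta>"]) auto
qed auto

lemma cauchy_formula_boundary:
  assumes sc: "simply_connected G" and z: "z \<in> G" and y: "\<zeta> \<in> range c"
  shows "(LINT x|lborel. indicator {0..1} x *\<^sub>R (H \<zeta> x / (c x - z))) =
      2 * pi * \<i> * winding_number c z * ((f z - fhat \<zeta>) / (\<zeta> - z))"
proof -
  obtain d t\<^sub>1 where d: "0 < d" "0 < t\<^sub>1" and far: "\<And>x t. 0 \<le> t \<Longrightarrow> t \<le> t\<^sub>1 \<Longrightarrow> d \<le> norm (\<gamma> t x - z)"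
    using gamma_far[OF z] by blast
  have "\<forall>\<^sub>F n in sequentially. \<tau> n < t\<^sub>1" using tau_tendsto d by (intro order_tendstoD) auto
  then obtain M where M: "\<And>n. n \<ge> M \<Longrightarrow> \<tau> n < t\<^sub>1" by (auto simp: eventually_sequentially)
  \<comment> \<open>Dropping the first M terms keeps every curve of the sequence at distance at
    least d from z, so the Cauchy formula holds for all n with the same value.\<close>
  define T where "T n = \<tau> (n + M)" for n
  have T: "0 < T n" "T n \<le> t\<^sub>0" "T n \<le> t\<^sub>1" for n
    using tau_pos tau_le M by (auto simp: T_def less_imp_le)
  have Tlim: "T \<longlonglongrightarrow> 0" unfolding T_def using tau_tendsto by (rule LIMSEQ_ignore_initial_segment)
  have far': "\<gamma> s x \<noteq> z" if "0 \<le> s" "s \<le> T n" for s x n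
    using far[of s x] that T[of n] d by auto
  let ?s = "\<lambda>n x. indicator {0..1} x *\<^sub>R
      ((f (\<gamma> (T n) x) - fhat \<zeta>) / (\<zeta> - \<gamma> (T n) x) / (\<gamma> (T n) x - z) * (c' x + of_real (T n) * N' x))"
  let ?V = "2 * pi * \<i> * winding_number c z * ((f z - fhat \<zeta>) / (\<zeta> - z))"
  \<comment> \<open>The factors stem from the Hoelder bound, the lower bound for |\<zeta> -
    \<gamma>|, the distance to z and the speed bound. What remains is (T n + r)^-b, which is at most
    r^-b for every n.\<close>
  define Q where "Q = K\<^sub>3 / (\<kappa> / (1 + L)) / d * B\<^sub>2"
  have "(\<lambda>n. LINT x|lborel. ?s n x) \<longlonglongrightarrow> (LINT x|lborel. indicator {0..1} x *\<^sub>R (H \<zeta> x / (c x - z)))"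
  proof (rule integral_dominated_convergence[where w = "\<lambda>x. Q * (indicator {0..1} x * norm (c x - \<zeta>) powr (- b))"])
    show "(\<lambda>x. indicator {0..1} x *\<^sub>R (H \<zeta> x / (c x - z))) \<in> borel_measurable lborel"
      unfolding H_def by measurable
    show "?s n \<in> borel_measurable lborel" for n
      by (rule borel_measurable_integrable, rule cauchy_formula_gamma(2)[OF sc z y T(1,2) far'])
    show "integrable lborel (\<lambda>x. Q * (indicator {0..1} x * norm (c x - \<zeta>) powr (- b)))"
      using y chord_powr_integrable by auto
    show "AE x in lborel. (\<lambda>n. ?s n x) \<longlonglongrightarrow> indicator {0..1} x *\<^sub>R (H \<zeta> x / (c x - z))"
      using AE_chord[of \<zeta>]
    proof eventually_elim
      case (elim x)
      have "(\<lambda>n. \<gamma> (T n) x) \<longlonglongrightarrow> c x + of_real 0 * N x"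
        unfolding \<gamma>_def by (intro tendsto_intros Tlim)
      then have g: "(\<lambda>n. \<gamma> (T n) x) \<longlonglongrightarrow> c x" by simp
      have fl: "(\<lambda>n. f (\<gamma> (T n) x)) \<longlonglongrightarrow> fhat (c x)"
        unfolding T_def fhat_c using fb_LIMSEQ by (rule LIMSEQ_ignore_initial_segment)
      have "(\<lambda>n. (f (\<gamma> (T n) x) - fhat \<zeta>) / (\<zeta> - \<gamma> (T n) x) / (\<gamma> (T n) x - z) * (c' x + of_real (T n) * N' x)) \<longlonglongrightarrow>
          (fhat (c x) - fhat \<zeta>) / (\<zeta> - c x) / (c x - z) * (c' x + of_real 0 * N' x)"
        using elim z G_disjoint by (intro tendsto_intros g fl Tlim) auto
      then have "(\<lambda>n. ?s n x) \<longlonglongrightarrow> indicator {0..1} x *\<^sub>R ((fhat (c x) - fhat \<zeta>) / (\<zeta> - c x) / (c x - z) * (c' x + of_real 0 * N' x))"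
        by (rule tendsto_scaleR[OF tendsto_const])
      then show ?case by (simp add: H_def)
    qed
    show "AE x in lborel. norm (?s n x) \<le> Q * (indicator {0..1} x * norm (c x - \<zeta>) powr (- b))" for n
      using AE_chord[of \<zeta>]
    proof eventually_elim
      case (elim x)
      define r where "r = norm (c x - \<zeta>)"
      have r: "0 < r" using elim by (simp add: r_def)
      have 1: "norm (f (\<gamma> (T n) x) - fhat \<zeta>) \<le> K\<^sub>3 * (T n + r) powr a"
        using holder_interior_chord[OF T(1,2)] y by (auto simp: r_def)
      have 2: "\<kappa> / (1 + L) * (T n + r) \<le> norm (\<zeta> - \<gamma> (T n) x)"
        using chord_gamma[of "T n" x] T[of n] y by (auto simp: r_def norm_minus_commute less_imp_le)
      have 3: "d \<le> norm (\<gamma> (T n) x - z)" using far T[of n] by (simp add: less_imp_le)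
      have 4: "norm (c' x + of_real (T n) * N' x) \<le> B\<^sub>2" using gamma_deriv_bound T[of n] by (simp add: less_imp_le)
      have "norm ((f (\<gamma> (T n) x) - fhat \<zeta>) / (\<zeta> - \<gamma> (T n) x) / (\<gamma> (T n) x - z) * (c' x + of_real (T n) * N' x)) \<le>
          K\<^sub>3 * (T n + r) powr a / (\<kappa> / (1 + L) * (T n + r)) / d * B\<^sub>2"
        unfolding norm_mult norm_divide
        using 1 2 3 4 d r T[of n] kappa_pos L_pos K3_nonneg
        by (intro mult_mono frac_le) auto
      also have "(T n + r) powr a = (T n + r) powr (- b) * (T n + r)"
        using r T(1)[of n] powr_add[of "T n + r" "- b" 1] by simp
      also have "K\<^sub>3 * ((T n + r) powr (- b) * (T n + r)) / (\<kappa> / (1 + L) * (T n + r)) / d * B\<^sub>2 = Q * (T n + r) powr (- b)"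
        using r T(1)[of n] by (simp add: Q_def)
      also have "\<dots> \<le> Q * r powr (- b)"
        using r T(1)[of n] b K3_nonneg kappa_pos L_pos d B2_nonneg
        by (intro mult_left_mono powr_mono2') (auto simp: Q_def)
      finally show ?case
        by (simp add: r_def indicator_def)
    qed
  qed
  moreover have "(LINT x|lborel. ?s n x) = ?V" for n
    by (rule cauchy_formula_gamma(1)[OF sc z y T(1,2) far'])
  ultimately show ?thesis by (simp add: LIMSEQ_const_iff)
qed

lemma cauchy_rep_multiplier:
  assumes sc: "simply_connected G" and bdd: "bounded G"
    and M: "finite_measure M" and sM: "sets M = sets (restrict_space borel (range c))"
  shows "cauchy_rep (range c) G (\<lambda>z. f z * (LINT \<zeta>|M. 1 / (\<zeta> - z)))"
proof -
  let ?X = "restrict_space (borel :: complex measure) (range c)"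
  interpret finite_measure M by (rule M)
  interpret P: pair_sigma_finite M "lborel :: real measure" by unfold_locales
  obtain w where w: "w \<noteq> 0" "\<And>z. z \<in> G \<Longrightarrow> winding_number c z = w"
    using winding_number_const[OF bdd] by blast
  have spM: "space M = range c" using sets_eq_imp_space_eq[OF sM] by (simp add: space_restrict_space)
  have id_meas: "(\<lambda>\<zeta>. \<zeta>) \<in> measurable M ?X" using sM by (rule measurable_ident_sets)
  have [measurable]: "(\<lambda>\<zeta>. \<zeta>) \<in> borel_measurable M"
    using id_meas by (simp add: measurable_restrict_space2_iff)
  have "fhat \<in> borel_measurable ?X"
    by (rule borel_measurable_continuous_on_restrict[OF continuous_fhat])
  then have [measurable]: "fhat \<in> borel_measurable M"
    using sM by (simp cong: measurable_cong_sets)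
  have c_meas: "c \<in> measurable lborel ?X"
    by (rule measurable_restrict_space2) auto
  define \<Phi> where "\<Phi> = (\<lambda>\<zeta> x. indicator {0..1} x *\<^sub>R H \<zeta> x)"
  have \<Phi>_meas[measurable]: "case_prod \<Phi> \<in> borel_measurable (M \<Otimes>\<^sub>M lborel)"
    unfolding \<Phi>_def H_def case_prod_beta' by measurable
  \<comment> \<open>The inner integral is at most \<open>K\<^sub>3\<close> L J for every \<zeta>, so
    finiteness of M gives joint integrability.\<close>
  have \<Phi>_int: "integrable (M \<Otimes>\<^sub>M lborel) (case_prod \<Phi>)"
  proof (rule integrableI_bounded[OF \<Phi>_meas])
    have "(\<integral>\<^sup>+p. ennreal (norm (case_prod \<Phi> p)) \<partial>(M \<Otimes>\<^sub>M lborel)) = (\<integral>\<^sup>+\<zeta>. \<integral>\<^sup>+x. ennreal (norm (\<Phi> \<zeta> x)) \<partial>lborel \<partial>M)"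
      by (subst lborel.nn_integral_fst[symmetric]) auto
    also have "\<dots> \<le> (\<integral>\<^sup>+\<zeta>. ennreal (K\<^sub>3 * L) * ennreal J \<partial>M)"
    proof (rule nn_integral_mono)
      fix \<zeta> assume "\<zeta> \<in> space M"
      then have \<zeta>: "\<zeta> \<in> range c" by (simp add: spM)
      have "(\<integral>\<^sup>+x. ennreal (norm (\<Phi> \<zeta> x)) \<partial>lborel) \<le>
          (\<integral>\<^sup>+x. ennreal (K\<^sub>3 * L) * ennreal (indicator {0..1} x * norm (c x - \<zeta>) powr (- b)) \<partial>lborel)"
        using H_bound[OF \<zeta>] K3_nonneg L_pos
        by (intro nn_integral_mono) (auto simp: \<Phi>_def indicator_def ennreal_mult[symmetric] intro!: ennreal_leI)
      also have "\<dots> = ennreal (K\<^sub>3 * L) * (\<integral>\<^sup>+x. ennreal (indicator {0..1} x * norm (c x - \<zeta>) powr (- b)) \<partial>lborel)"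
        by (rule nn_integral_cmult) measurable
      also have "\<dots> \<le> ennreal (K\<^sub>3 * L) * ennreal J"
        using \<zeta> chord_powr_integral by (intro mult_left_mono) auto
      finally show "(\<integral>\<^sup>+x. ennreal (norm (\<Phi> \<zeta> x)) \<partial>lborel) \<le> ennreal (K\<^sub>3 * L) * ennreal J" .
    qed
    also have "\<dots> < \<infinity>"
      by (simp add: ennreal_mult_less_top emeasure_eq_measure)
    finally show "(\<integral>\<^sup>+p. ennreal (norm (case_prod \<Phi> p)) \<partial>(M \<Otimes>\<^sub>M lborel)) < \<infinity>" .
  qed
  \<comment> \<open>Up to the factor 1 / (2 pi \<i> w), the density in the parameter of the part to
    be added to \<open>fhat\<close> M.\<close>
  define \<psi> where "\<psi> = (\<lambda>x. LINT \<zeta>|M. \<Phi> \<zeta> x)"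
  have \<psi>_int: "integrable lborel \<psi>"
    unfolding \<psi>_def by (rule P.integrable_snd[OF \<Phi>_int])
  have fhat_int: "integrable M fhat"
  proof (rule integrable_const_bound[where B = F])
    show "AE \<zeta> in M. norm (fhat \<zeta>) \<le> F"
      by (rule AE_I2) (auto simp: spM fhat_c fb_bound)
  qed measurable
  have r1: "cauchy_rep (range c) G (\<lambda>z. LINT \<zeta>|M. fhat \<zeta> / (\<zeta> - z))"
    by (rule cauchy_rep_integral[OF fhat_int id_meas G(1) G_disjoint])
  have r2: "cauchy_rep (range c) G (\<lambda>z. LINT x|lborel. \<psi> x / (c x - z))"
    by (rule cauchy_rep_integral[OF \<psi>_int c_meas G(1) G_disjoint])
  show ?thesis
  proof (rule cauchy_rep_cong[OF cauchy_rep_add[OF r1 cauchy_rep_scale[OF r2, of "1 / (2 * pi * \<i> * w)"]]])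
    fix z assume z: "z \<in> G"
    obtain K where K: "\<And>\<zeta>. \<zeta> \<in> range c \<Longrightarrow> norm (1 / (\<zeta> - z)) \<le> K"
      using cauchy_kernel_bounded[OF G(1) G_disjoint z] by blast
    have i0: "integrable M (\<lambda>\<zeta>. 1 / (\<zeta> - z))"
      by (rule integrable_const_bound[where B = K]) (use K spM in auto)
    have i1: "integrable M (\<lambda>\<zeta>. fhat \<zeta> / (\<zeta> - z))"
    proof (rule integrable_const_bound[where B = "F * K"])
      show "AE \<zeta> in M. norm (fhat \<zeta> / (\<zeta> - z)) \<le> F * K"
      proof (rule AE_I2)
        fix \<zeta> assume "\<zeta> \<in> space M"
        then have "norm (fhat \<zeta>) * norm (1 / (\<zeta> - z)) \<le> F * K"
          using K F_nonneg by (intro mult_mono) (auto simp: spM fhat_c fb_bound)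
        then show "norm (fhat \<zeta> / (\<zeta> - z)) \<le> F * K" by (simp add: norm_divide)
      qed
    qed measurable
    have \<Psi>_int: "integrable (M \<Otimes>\<^sub>M lborel) (case_prod (\<lambda>\<zeta> x. \<Phi> \<zeta> x / (c x - z)))"
    proof (rule Bochner_Integration.integrable_bound)
      show "integrable (M \<Otimes>\<^sub>M lborel) (\<lambda>p. K *\<^sub>R case_prod \<Phi> p)" using \<Phi>_int by simp
      show "case_prod (\<lambda>\<zeta> x. \<Phi> \<zeta> x / (c x - z)) \<in> borel_measurable (M \<Otimes>\<^sub>M lborel)"
        unfolding \<Phi>_def H_def case_prod_beta' by measurable
      have "norm (\<Phi> \<zeta> x / (c x - z)) \<le> norm (K *\<^sub>R \<Phi> \<zeta> x)" for \<zeta> x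
      proof -
        have "norm (1 / (c x - z)) \<le> \<bar>K\<bar>" using K[of "c x"] by auto
        then have "norm (\<Phi> \<zeta> x) * norm (1 / (c x - z)) \<le> norm (\<Phi> \<zeta> x) * \<bar>K\<bar>" by (intro mult_left_mono) auto
        then show ?thesis by (simp add: norm_divide mult.commute)
      qed
      then show "AE p in M \<Otimes>\<^sub>M lborel. norm (case_prod (\<lambda>\<zeta> x. \<Phi> \<zeta> x / (c x - z)) p) \<le> norm (K *\<^sub>R case_prod \<Phi> p)"
        by (auto simp: case_prod_beta')
    qed
    have "f z * (LINT \<zeta>|M. 1 / (\<zeta> - z)) - (LINT \<zeta>|M. fhat \<zeta> / (\<zeta> - z)) =
        (LINT \<zeta>|M. f z * (1 / (\<zeta> - z)) - fhat \<zeta> / (\<zeta> - z))"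
      using Bochner_Integration.integral_diff[OF integrable_mult_right[OF i0, of "f z"] i1]
      by (simp only: integral_mult_right_zero)
    also have "\<dots> = (LINT \<zeta>|M. 1 / (2 * pi * \<i> * w) * (LINT x|lborel. \<Phi> \<zeta> x / (c x - z)))"
    proof (rule Bochner_Integration.integral_cong[OF refl])
      fix \<zeta> assume "\<zeta> \<in> space M"
      then have \<zeta>: "\<zeta> \<in> range c" by (simp add: spM)
      have "(LINT x|lborel. \<Phi> \<zeta> x / (c x - z)) = (LINT x|lborel. indicator {0..1} x *\<^sub>R (H \<zeta> x / (c x - z)))"
        by (simp add: \<Phi>_def scaleR_conv_of_real)
      also have "\<dots> = 2 * pi * \<i> * w * ((f z - fhat \<zeta>) / (\<zeta> - z))"
        using cauchy_formula_boundary[OF sc z \<zeta>] w(2)[OF z] by simp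
      finally show "f z * (1 / (\<zeta> - z)) - fhat \<zeta> / (\<zeta> - z) = 1 / (2 * pi * \<i> * w) * (LINT x|lborel. \<Phi> \<zeta> x / (c x - z))"
        using w(1) by (simp add: diff_divide_distrib)
    qed
    also have "\<dots> = 1 / (2 * pi * \<i> * w) * (LINT \<zeta>|M. (LINT x|lborel. \<Phi> \<zeta> x / (c x - z)))"
      by (rule integral_mult_right_zero)
    also have "(LINT \<zeta>|M. (LINT x|lborel. \<Phi> \<zeta> x / (c x - z))) = (LINT x|lborel. (LINT \<zeta>|M. \<Phi> \<zeta> x / (c x - z)))"
      by (rule P.Fubini_integral[OF \<Psi>_int, symmetric])
    also have "\<dots> = (LINT x|lborel. \<psi> x / (c x - z))"
      by (simp add: \<psi>_def)
    finally show "f z * (LINT \<zeta>|M. 1 / (\<zeta> - z)) = (LINT \<zeta>|M. fhat \<zeta> / (\<zeta> - z)) + 1 / (2 * pi * \<i> * w) * (LINT x|lborel. \<psi> x / (c x - z))"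
      by (simp add: algebra_simps)
  qed
qed

end

section \<open>From the arc length parametrization to the multiplier property\<close>

lemma smooth_jordan_curve_loop:
  assumes "smooth_jordan_curve l"
  obtains c c' L where "smooth_loop c c' L" "range c = l"
proof -
  obtain L :: real and g :: "real \<Rightarrow> complex" where L: "L > 0" and per: "\<And>s. g (s + L) = g s"
    and inj: "inj_on g {0..<L}" and img: "g ` {0..<L} = l" and C1: "g C1_differentiable_on UNIV"
    and sp: "\<And>s. norm (vector_derivative g (at s)) = 1"
    using assms unfolding smooth_jordan_curve_def by blast
  obtain D where D: "\<And>s. (g has_vector_derivative D s) (at s)" "continuous_on UNIV D"
    using C1 unfolding C1_differentiable_on_def by auto
  have nD: "norm (D s) = 1" for s using sp[of s] vector_derivative_at[OF D(1)] by simp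
  define c where "c x = g (L * x)" for x
  define c' where "c' x = of_real L * D (L * x)" for x
  have im: "(\<lambda>x. L * x) ` {0..<1} = {0..<L}"
  proof (intro equalityI subsetI)
    fix s assume "s \<in> {0..<L}"
    then show "s \<in> (\<lambda>x. L * x) ` {0..<1}" using L by (intro image_eqI[of _ _ "s / L"]) auto
  qed (use L in auto)
  have loop: "smooth_loop c c' L"
  proof
    show "c (x + 1) = c x" for x using per[of "L * x"] by (simp add: c_def algebra_simps)
    show "(c has_vector_derivative c' x) (at x)" for x
    proof -
      have "((\<lambda>x. L * x) has_vector_derivative L) (at x)"
        unfolding has_real_derivative_iff_has_vector_derivative[symmetric]
        by (auto intro!: derivative_eq_intros)
      from vector_diff_chain_at[OF this D(1)] show ?thesis
        by (simp add: o_def c_def[abs_def] c'_def scaleR_conv_of_real)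
    qed
    show "continuous_on UNIV c'"
      unfolding c'_def by (intro continuous_intros continuous_on_compose2[OF D(2)]) auto
    show "norm (c' x) = L" for x using L by (simp add: c'_def norm_mult nD)
    show "L > 0" by (rule L)
    show "inj_on c {0..<1}"
    proof (rule inj_onI)
      fix x y assume xy: "x \<in> {0..<1}" "y \<in> {0..<1}" "c x = c y"
      have "L * x \<in> {0..<L}" "L * y \<in> {0..<L}" using xy im by blast+
      then have "L * x = L * y" using xy(3) inj by (auto simp: c_def dest: inj_onD)
      then show "x = y" using L by simp
    qed
  qed
  interpret smooth_loop c c' L by (rule loop)
  have "range c = g ` ((\<lambda>x. L * x) ` {0..<1})" unfolding range_eq image_image c_def ..
  then have "range c = l" using img im by simp
  with loop show ?thesis using that by blast
qed

theorem theorem2: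
  fixes l G :: "complex set" and \<phi> f :: "complex \<Rightarrow> complex" and p :: ereal
  assumes "smooth_jordan_curve l"
    and "open G" and "connected G" and "bounded G" and "frontier G = l"
    and "conformal_onto \<phi> (ball 0 1) G"
    and "f \<in> smirnov_class \<phi> G \<infinity>"
    and "1 < p" and "deriv f \<in> smirnov_class \<phi> G p"
  shows "f \<in> cauchy_multipliers l G"
proof -
  have hol: "f holomorphic_on G" and "bounded (f ` G)"
    using assms(7) by (auto simp: smirnov_class_def)
  then obtain F where F: "\<And>z. z \<in> G \<Longrightarrow> norm (f z) \<le> F" by (auto simp: bounded_iff)
  have ne: "G \<noteq> {}" using assms(6) by (auto simp: conformal_onto_def)
  \<comment> \<open>Inherited from the disc through \<phi> and its inverse; it makes the Cauchy
    formula available for closed curves in G.\<close>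
  have sc: "simply_connected G"
  proof -
    have \<phi>: "\<phi> holomorphic_on ball 0 1" "inj_on \<phi> (ball 0 1)" "\<phi> ` ball 0 1 = G"
      using assms(6) by (auto simp: conformal_onto_def)
    obtain \<psi> where "\<psi> holomorphic_on \<phi> ` ball 0 1" "\<And>z. z \<in> ball 0 1 \<Longrightarrow> \<psi> (\<phi> z) = z"
      by (rule holomorphic_has_inverse[OF \<phi>(1) open_ball \<phi>(2)]) blast
    with \<phi> have "\<exists>f g. f holomorphic_on G \<and> g holomorphic_on ball 0 1 \<and>
        (\<forall>z\<in>G. f z \<in> ball 0 1 \<and> g (f z) = z) \<and> (\<forall>z\<in>ball 0 1. g z \<in> G \<and> f (g z) = z)"
      by (intro exI[of _ \<psi>] exI[of _ \<phi>]) auto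
    then show ?thesis using simply_connected_eq_biholomorphic_to_disc[OF assms(2)] by blast
  qed
  obtain C b :: real where Cb: "0 \<le> C" "0 < b" "b < 1"
    "\<And>z d. z \<in> G \<Longrightarrow> 0 < d \<Longrightarrow> ball z d \<subseteq> G \<Longrightarrow> norm (deriv f z) \<le> C * d powr (- b)"
    using smirnov_pointwise_bound[OF assms(6,8,4,9)] by blast
  obtain c c' L where c: "smooth_loop c c' L" "range c = l"
    using smooth_jordan_curve_loop[OF assms(1)] by blast
  interpret smooth_loop c c' L by (rule c)
  have fr: "frontier G = range c" using assms(5) c by simp
  obtain N N' t\<^sub>0 \<kappa> B where N: "0 < t\<^sub>0" "0 < \<kappa>"
    "\<And>x. N (x + 1) = N x" "\<And>x. (N has_vector_derivative N' x) (at x)" "continuous_on UNIV N'"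
    "\<And>x. norm (N x) \<le> B" "\<And>x. norm (N' x) \<le> B"
    "\<And>x t. 0 < t \<Longrightarrow> t \<le> t\<^sub>0 \<Longrightarrow> c x + of_real t * N x \<in> G"
    "\<And>x y t. \<bar>x - y\<bar> \<le> 1/2 \<Longrightarrow> 0 \<le> t \<Longrightarrow> t \<le> t\<^sub>0 \<Longrightarrow>
       \<kappa> * (t + \<bar>x - y\<bar>) \<le> norm (c x + of_real t * N x - c y)"
    using inner_collar[OF assms(2) fr ne] by metis
  interpret collar c c' L G N N' t\<^sub>0 \<kappa> B f F C b
    by unfold_locales (use assms(2) fr N hol F Cb in auto)
  have disj: "G \<inter> l = {}" using G_disjoint c by simp
  have "(\<lambda>z. f z * g z) \<in> cauchy_class l G" if g: "g \<in> cauchy_class l G" for g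
  proof (rule cauchy_rep_imp_class[OF _ _ assms(2) disj])
    show "(\<lambda>z. f z * g z) holomorphic_on G"
      using g hol by (intro holomorphic_on_mult) (auto simp: cauchy_class_def)
    obtain ms where "\<forall>m\<in>set ms. finite_measure (snd m) \<and> sets (snd m) = sets (restrict_space borel l)"
      "\<forall>z\<in>G. g z = (\<Sum>m\<leftarrow>ms. fst m * (LINT \<zeta>|snd m. 1 / (\<zeta> - z)))"
      using cauchy_class_imp_rep[OF g] unfolding cauchy_rep_def case_prod_beta' by (elim exE conjE)
    then have ms: "\<And>m. m \<in> set ms \<Longrightarrow> finite_measure (snd m) \<and> sets (snd m) = sets (restrict_space borel l)"
      "\<And>z. z \<in> G \<Longrightarrow> g z = (\<Sum>m\<leftarrow>ms. fst m * (LINT \<zeta>|snd m. 1 / (\<zeta> - z)))"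
      by fast+
    \<comment> \<open>Multiplication by f acts on each entry of the list separately, so the case of
      one positive measure suffices.\<close>
    have "cauchy_rep l G (\<lambda>z. \<Sum>m\<leftarrow>ms. fst m * (f z * (LINT \<zeta>|snd m. 1 / (\<zeta> - z))))"
      using cauchy_rep_multiplier[OF sc assms(4)] ms(1) c(2)
      by (intro cauchy_rep_sum_list cauchy_rep_scale) auto
    then show "cauchy_rep l G (\<lambda>z. f z * g z)"
      by (rule cauchy_rep_cong) (simp add: ms(2) mult.left_commute flip: sum_list_const_mult)
  qed
  then show ?thesis using hol by (auto simp: cauchy_multipliers_def)
qed

end
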